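(* Let $\alpha>0$ be a non-integer real number and $m=\lceil\alpha\rceil$. Let $\beta\in\mathbb{R}$, let $a\neq0$ be a real number, and let $x>a$. Then $${}_aI_x^{\alpha}\left(1+\frac{x^2}{2}\right)^{\frac{\beta}{2}}=\Gamma(1+\beta/2)\,(x-a)^{\alpha}\sum_{n=0}^{\infty}\frac{(2n)!}{2^n\,n!\,\Gamma(\beta/2-n+1)}\left(\sum_{k=0}^{2n}\frac{a^{2n-k}(x-a)^k}{(2n-k)!\,\Gamma(\alpha+k+1)}\right),$$ $${}_aD_x^{\alpha}\left(1+\frac{x^2}{2}\right)^{\frac{\beta}{2}}=\Gamma(1+\beta/2)\,(x-a)^{-\alpha}\sum_{n=0}^{\infty}\frac{(2n)!}{2^n\,n!\,\Gamma(\beta/2-n+1)}\left(\sum_{k=0}^{2n}\frac{a^{2n-k}(x-a)^k}{(2n-k)!\,\Gamma(k-\alpha+1)}\right),$$ $${}_a^{C}D_x^{\alpha}\left(1+\frac{x^2}{2}\right)^{\frac{\beta}{2}}=\Gamma(1+\beta/2)\,a^{-m}(x-a)^{m-\alpha}\sum_{n=0}^{\infty}\frac{(2n)!}{2^n\,n!\,\Gamma(\beta/2-n+1)}\left(\sum_{k=0}^{2n-m}\frac{a^{2n-k}(x-a)^k}{(2n-m-k)!\,\Gamma(m-\alpha+k+1)}\right).$$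
   Context: Throughout, $\alpha>0$ is a non-integer real number and $m=\lceil\alpha\rceil$. For a function $f$ and $x>a$: the left-sided Riemann-Liouville fractional integral of order $\alpha$ is ${}_aI_x^{\alpha}f(x)=\frac{1}{\Gamma(\alpha)}\int_a^x(x-\tau)^{\alpha-1}f(\tau)\,d\tau$; the left-sided Riemann-Liouville fractional derivative of order $\alpha$ is ${}_aD_x^{\alpha}f(x)=\frac{1}{\Gamma(m-\alpha)}\frac{d^m}{dx^m}\int_a^x(x-\tau)^{m-\alpha-1}f(\tau)\,d\tau$; the left-sided Caputo fractional derivative of order $\alpha$ is ${}_a^{C}D_x^{\alpha}f(x)=\frac{1}{\Gamma(m-\alpha)}\int_a^x(x-\tau)^{m-\alpha-1}f^{(m)}(\tau)\,d\tau$. Notation such as ${}_aI_x^{\alpha}(1+x^2/2)^{\beta/2}$ means the operator applied to the function $\tau\mapsto(1+\tau^2/2)^{\beta/2}$, evaluated at $x$. $\Gamma$ is the Gamma function. A sum whose upper limit is smaller than its lower limit is empty, i.e. equal to $0$.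
   Formalization: Each identity is stated for β not in {-2,-4,…} and wherever its series converges (proved if |a|,|x|<√2 or β=0,2,4,…; it can diverge otherwise, e.g. β=1, a=1, x=2). For β=-2,-4,…, where Γ(1+β/2) is undefined, the right side is read as a limit in β, for |a|,|x|<√2. *)

theory Defs
  imports "HOL-Analysis.Analysis"
begin

text \<open>
  Left-sided fractional operators with base point \<open>a\<close>, for functions on the real line; they are
  meant for non-integer \<open>\<alpha> > 0\<close> and evaluation points \<open>x > a\<close>. The integrals are
  Henstock--Kurzweil integrals, which also cover the (absolutely convergent) integrals with a kernel
  that is singular at the upper end point.
\<close>

definition RL_integral :: "real \<Rightarrow> real \<Rightarrow> (real \<Rightarrow> real) \<Rightarrow> real \<Rightarrow> real" where
  "RL_integral a \<alpha> f x =
     1 / Gamma \<alpha> * integral {a..x} (\<lambda>t. (x - t) powr (\<alpha> - 1) * f t)"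

definition RL_deriv :: "real \<Rightarrow> real \<Rightarrow> (real \<Rightarrow> real) \<Rightarrow> real \<Rightarrow> real" where
  "RL_deriv a \<alpha> f x =
     (let m = nat \<lceil>\<alpha>\<rceil> in
      1 / Gamma (real m - \<alpha>) *
        (deriv ^^ m) (\<lambda>y. integral {a..y} (\<lambda>t. (y - t) powr (real m - \<alpha> - 1) * f t)) x)"

definition Caputo_deriv :: "real \<Rightarrow> real \<Rightarrow> (real \<Rightarrow> real) \<Rightarrow> real \<Rightarrow> real" where
  "Caputo_deriv a \<alpha> f x =
     (let m = nat \<lceil>\<alpha>\<rceil> in
      1 / Gamma (real m - \<alpha>) *
        integral {a..x} (\<lambda>t. (x - t) powr (real m - \<alpha> - 1) * (deriv ^^ m) f t))"

text \<open>
  The terms of the three series, for the function \<open>t \<mapsto> (1 + t\<^sup>2 / 2) powr (\<beta> / 2)\<close>. If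
  \<open>\<beta> / 2 - n + 1\<close> is a pole of the Gamma function, the library values \<open>Gamma _ = 0\<close> and
  \<open>_ / 0 = 0\<close> give the usual convention that the reciprocal of Gamma vanishes at the poles.
  In the third sum, \<open>k + m \<le> 2 * n\<close> stands for \<open>k \<le> 2 * n - m\<close> with the difference taken
  in the integers, so that the sum is empty if \<open>2 * n < m\<close>.
\<close>

definition RL_integral_term :: "real \<Rightarrow> real \<Rightarrow> real \<Rightarrow> real \<Rightarrow> nat \<Rightarrow> real" where
  "RL_integral_term a \<alpha> x \<beta> n =
     fact (2 * n) / (2 ^ n * fact n * Gamma (\<beta> / 2 - real n + 1)) *
       (\<Sum>k = 0..2 * n. a ^ (2 * n - k) * (x - a) ^ k /
          (fact (2 * n - k) * Gamma (\<alpha> + real k + 1)))"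

definition RL_deriv_term :: "real \<Rightarrow> real \<Rightarrow> real \<Rightarrow> real \<Rightarrow> nat \<Rightarrow> real" where
  "RL_deriv_term a \<alpha> x \<beta> n =
     fact (2 * n) / (2 ^ n * fact n * Gamma (\<beta> / 2 - real n + 1)) *
       (\<Sum>k = 0..2 * n. a ^ (2 * n - k) * (x - a) ^ k /
          (fact (2 * n - k) * Gamma (real k - \<alpha> + 1)))"

definition Caputo_deriv_term :: "real \<Rightarrow> real \<Rightarrow> real \<Rightarrow> real \<Rightarrow> nat \<Rightarrow> real" where
  "Caputo_deriv_term a \<alpha> x \<beta> n =
     (let m = nat \<lceil>\<alpha>\<rceil> in
      fact (2 * n) / (2 ^ n * fact n * Gamma (\<beta> / 2 - real n + 1)) *
        (\<Sum>k | k + m \<le> 2 * n. a ^ (2 * n - k) * (x - a) ^ k /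
          (fact (2 * n - m - k) * Gamma (real m - \<alpha> + real k + 1))))"

end

theory Submission
  imports Defs "HOL-Complex_Analysis.Complex_Analysis"
begin

text \<open>
  Write \<open>f\<^sub>s(t) = (1 + s t\<^sup>2 / 2) powr (\<beta> / 2)\<close> with an additional complex parameter \<open>s\<close>, so that
  the function of the theorem is \<open>f\<^sub>1\<close>, and let \<open>M = max \<bar>a\<bar> \<bar>x\<bar>\<close>. Each of the three operators,
  applied to \<open>f\<^sub>s\<close> and evaluated at \<open>x\<close>, is a function \<open>\<Psi>(s)\<close> that is holomorphic on the half plane
  \<open>Re s > - 2 / M\<^sup>2\<close>, because \<open>1 + s t\<^sup>2 / 2\<close> stays in the right half plane for \<open>t\<close> between \<open>a\<close> and
  \<open>x\<close> (\<open>rl_binom_holomorphic\<close>). On the disc \<open>\<bar>s\<bar> < 2 / M\<^sup>2\<close> the binomial series converges uniformly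
  in \<open>t\<close> together with all its derivatives, so there \<open>\<Psi>(s)\<close> is the power series
  \<open>\<Sum>n. (\<beta>/2 gchoose n) / 2 ^ n * N n * s ^ n\<close>, where \<open>N n\<close> is the operator applied to the monomial
  \<open>t ^ (2 n)\<close> (\<open>rl_binom_sums\<close>). The numbers \<open>N n\<close> come from Beta integrals, and up to the factors
  outside the sum the coefficients of this power series are the terms in the statement.

  If \<open>M < sqrt 2\<close>, the point \<open>s = 1\<close> lies in the disc and the series converges there. If nothing is
  known about \<open>M\<close> but the series happens to converge at \<open>s = 1\<close>, it converges on the open unit disc,
  agrees with \<open>\<Psi>\<close> on the intersection of that disc with the half plane by the identity theorem, and
  tends to its own sum as \<open>s\<close> increases to \<open>1\<close> by Abel's limit theorem; as \<open>\<Psi>\<close> is continuous at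
  \<open>1\<close>, the sum is \<open>\<Psi>(1)\<close> (\<open>convergent_series_eq_continuation\<close>).
  If \<open>1 + \<beta> / 2\<close> is a pole of Gamma, the prefactor has no meaning, but \<open>\<Psi>(1)\<close> depends continuously
  on \<open>\<beta>\<close>, which gives the limit statements.

  The three operators are treated at once: all are of the form \<open>d\<^sup>j/dy\<^sup>j\<close> of the integral of
  \<open>(y - t) powr (\<mu> - 1)\<close> against the \<open>p\<close>-th derivative of the function, up to a constant factor, with
  \<open>(\<mu>, j, p)\<close> equal to \<open>(\<alpha>, 0, 0)\<close>, \<open>(m - \<alpha>, m, 0)\<close> and \<open>(m - \<alpha>, 0, m)\<close>. A substitution
  removes the singularity of the kernel and moves the dependence on \<open>y\<close> into a smooth integrand
  (\<open>rl_kernel_has_integral\<close>), after which every differentiation and every exchange of limits is one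
  for a continuous integrand on \<open>{0..1}\<close>.
\<close>

section \<open>Abel's limit theorem and analytic continuation\<close>

text \<open>
  Summation by parts expresses \<open>(\<Sum>n. c n * r ^ n) - suminf c\<close> as \<open>- (1 - r) * (\<Sum>n. T (n + 1) * r ^ n)\<close>
  with the tails \<open>T n\<close> of \<open>c\<close>. The tails are small from some \<open>N\<close> on, where the geometric series
  cancels the factor \<open>1 - r\<close>; the remaining finitely many terms vanish with that factor.
\<close>
theorem Abel_limit:
  fixes c :: "nat \<Rightarrow> complex"
  assumes "summable c"
  shows "((\<lambda>r. \<Sum>n. c n * of_real r ^ n) \<longlongrightarrow> suminf c) (at_left (1::real))"
proof -
  define T where "T n = (\<Sum>k. c (k + n))" for n
  have T_diff: "c n = T n - T (Suc n)" for n
    using suminf_split_head[of "\<lambda>k. c (k + n)"] assms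
    by (simp add: T_def)
  have T_lim: "T \<longlonglongrightarrow> 0"
    unfolding T_def by (rule suminf_exist_split2[OF assms])
  have T0: "T 0 = suminf c" by (simp add: T_def)
  obtain B where B: "norm (T n) \<le> B" for n
    using convergent_imp_Bseq[OF convergentI[OF T_lim]] by (auto simp: Bseq_def)
  have geo: "(\<lambda>n. B * r ^ n) sums (B * (1 / (1 - r)))" if "0 < r" "r < 1" for r B :: real
    using that by (intro sums_mult geometric_sums) auto
  have sT: "summable (\<lambda>n. norm (T (n + k) * of_real r ^ n))" if "0 < r" "r < 1" for r :: real and k
    using that B
    by (intro summable_comparison_test'[OF sums_summable[OF geo[of r B]]])
       (auto simp: norm_mult norm_power intro!: mult_right_mono)
  have parts: "(\<Sum>n. c n * of_real r ^ n) - suminf c =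
      - (of_real (1 - r) * (\<Sum>n. T (Suc n) * of_real r ^ n))" if r: "0 < r" "r < 1" for r :: real
  proof -
    have s0: "summable (\<lambda>n. T n * of_real r ^ n)" and s1: "summable (\<lambda>n. T (Suc n) * of_real r ^ n)"
      using summable_norm_cancel[OF sT[OF r, of 0]] summable_norm_cancel[OF sT[OF r, of 1]] by simp_all
    have "(\<Sum>n. c n * of_real r ^ n) = (\<Sum>n. T n * of_real r ^ n) - (\<Sum>n. T (Suc n) * of_real r ^ n)"
      by (subst suminf_diff[OF s0 s1]) (simp add: T_diff algebra_simps)
    also have "(\<Sum>n. T n * of_real r ^ n) = T 0 + (\<Sum>n. T (Suc n) * of_real r ^ Suc n)"
      using suminf_split_head[OF s0] by simp
    also have "(\<Sum>n. T (Suc n) * of_real r ^ Suc n) = of_real r * (\<Sum>n. T (Suc n) * of_real r ^ n)"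
      by (subst suminf_mult[OF s1, symmetric]) (simp add: mult_ac)
    finally show ?thesis by (simp add: T0 algebra_simps)
  qed
  have "((\<lambda>r. of_real (1 - r) * (\<Sum>n. T (Suc n) * of_real r ^ n)) \<longlongrightarrow> 0) (at_left (1::real))"
  proof (rule tendstoI)
    fix e :: real assume e: "e > 0"
    from T_lim[THEN tendstoD, of "e/2"] e obtain N where N: "\<And>n. n \<ge> N \<Longrightarrow> norm (T n) < e / 2"
      by (auto simp: eventually_sequentially)
    have "((\<lambda>r. (1 - r) * (\<Sum>n<N. norm (T (Suc n)))) \<longlongrightarrow> (1 - 1) * (\<Sum>n<N. norm (T (Suc n)))) (at_left (1::real))"
      by (intro tendsto_intros)
    then have "\<forall>\<^sub>F r in at_left (1::real). (1 - r) * (\<Sum>n<N. norm (T (Suc n))) < e / 2"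
      using e by (intro order_tendstoD) auto
    moreover have "\<forall>\<^sub>F r in at_left (1::real). 0 < r \<and> r < 1"
      by (intro eventually_conj eventually_at_leftI[of 0]) auto
    ultimately show "\<forall>\<^sub>F r in at_left (1::real). dist (of_real (1 - r) * (\<Sum>n. T (Suc n) * of_real r ^ n)) 0 < e"
    proof eventually_elim
      case (elim r)
      let ?g = "\<lambda>n. norm (T (Suc n) * of_real r ^ n)"
      have sg: "summable ?g" using sT[of r 1] elim by simp
      have "norm (\<Sum>n. T (Suc n) * of_real r ^ n) \<le> (\<Sum>n. ?g n)"
        by (rule summable_norm[OF sg])
      also have "\<dots> = (\<Sum>n<N. ?g n) + (\<Sum>n. ?g (n + N))"
        using suminf_split_initial_segment[OF sg, of N] by simp
      also have "(\<Sum>n<N. ?g n) \<le> (\<Sum>n<N. norm (T (Suc n)))"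
        using elim by (intro sum_mono) (auto simp: norm_mult norm_power mult_left_le power_le_one)
      also have "(\<Sum>n. ?g (n + N)) \<le> (\<Sum>n. e / 2 * r ^ n)"
      proof (rule suminf_le)
        fix n
        have "norm (T (Suc (n + N))) \<le> e / 2" using N[of "Suc (n + N)"] by simp
        moreover have "r ^ (n + N) \<le> r ^ n" using elim by (intro power_decreasing) auto
        ultimately show "?g (n + N) \<le> e / 2 * r ^ n"
          using elim e mult_mono[of "norm (T (Suc (n + N)))" "e / 2" "r ^ (n + N)" "r ^ n"]
          by (simp add: norm_mult norm_power)
        show "summable (\<lambda>n. ?g (n + N))" using summable_ignore_initial_segment[OF sg, of N] .
        show "summable (\<lambda>n. e / 2 * r ^ n)" using geo elim by (auto simp: sums_iff)
      qed
      also have "(\<Sum>n. e / 2 * r ^ n) = e / 2 * (1 / (1 - r))"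
        using geo[of r "e/2"] elim by (auto simp: sums_iff)
      finally have "norm (\<Sum>n. T (Suc n) * of_real r ^ n) \<le> (\<Sum>n<N. norm (T (Suc n))) + e / 2 / (1 - r)"
        by simp
      then have "(1 - r) * norm (\<Sum>n. T (Suc n) * of_real r ^ n) \<le>
          (1 - r) * ((\<Sum>n<N. norm (T (Suc n))) + e / 2 / (1 - r))"
        using elim by (intro mult_left_mono) auto
      also have "\<dots> = (1 - r) * (\<Sum>n<N. norm (T (Suc n))) + e / 2"
      proof -
        have "1 - r \<noteq> 0" using elim by simp
        then have "(1 - r) * (e / 2 / (1 - r)) = e / 2"
          by (subst times_divide_eq_right) (rule nonzero_mult_div_cancel_left)
        then show ?thesis by (simp only: distrib_left)
      qed
      also have "\<dots> < e" using elim by linarith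
      finally show ?case using elim by (simp only: dist_0_norm dist_norm diff_0_right norm_mult norm_of_real) simp
    qed
  qed
  then have lim0: "((\<lambda>r. suminf c - of_real (1 - r) * (\<Sum>n. T (Suc n) * of_real r ^ n)) \<longlongrightarrow> suminf c - 0) (at_left (1::real))"
    by (intro tendsto_intros)
  have ev: "\<forall>\<^sub>F r in at_left (1::real). suminf c - of_real (1 - r) * (\<Sum>n. T (Suc n) * of_real r ^ n) = (\<Sum>n. c n * of_real r ^ n)"
  proof (rule eventually_at_leftI[of 0])
    fix r :: real assume "r \<in> {0<..<1}"
    then show "suminf c - of_real (1 - r) * (\<Sum>n. T (Suc n) * of_real r ^ n) = (\<Sum>n. c n * of_real r ^ n)"
      using parts[of r] by (simp add: algebra_simps)
  qed simp
  from Lim_transform_eventually[OF lim0 ev] show ?thesis by simp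
qed

text \<open>
  The power series and \<open>F\<close> agree near \<open>0\<close>, hence on the convex intersection of the unit disc with the
  half plane, which contains \<open>{0..<1}\<close>; the limit at \<open>1\<close> along this segment is \<open>F 1\<close> for \<open>F\<close> and, by
  Abel's theorem, \<open>suminf d\<close> for the power series. The case \<open>\<rho> \<le> 1\<close> is the one of interest: then
  \<open>1\<close> is outside the disc where \<open>F\<close> is known to be the sum of the series.
\<close>
lemma convergent_series_eq_continuation:
  fixes F :: "complex \<Rightarrow> complex" and d :: "nat \<Rightarrow> complex"
  assumes hol: "F holomorphic_on {s. Re s > - \<rho>}" and \<rho>: "\<rho> > 0"
    and near: "\<And>s. norm s < \<rho> \<Longrightarrow> (\<lambda>n. d n * s ^ n) sums F s"
    and d: "summable d"
  shows "suminf d = F 1"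
proof -
  define G where "G s = (\<Sum>n. d n * s ^ n)" for s
  have sG: "(\<lambda>n. d n * s ^ n) sums G s" if "norm s < 1" for s
    unfolding G_def using powser_inside[of d 1 s] d that by (simp add: summable_sums)
  have G_hol: "G holomorphic_on ball 0 1"
    by (rule power_series_holomorphic[where a = d]) (use sG in simp)
  have opn: "open {s. Re s > - \<rho>}" by (simp add: open_halfspace_Re_gt)
  define S where "S = ball 0 1 \<inter> {s. Re s > - \<rho>}"
  have eq: "G s = F s" if "s \<in> S" for s
  proof (rule analytic_continuation_open[where f = G and g = F and s = "ball 0 (min 1 \<rho>)" and s' = S])
    show "connected S"
      unfolding S_def by (intro convex_connected convex_Int convex_ball convex_halfspace_Re_gt)
    show "ball 0 (min 1 \<rho>) \<subseteq> S"
      unfolding S_def using abs_Re_le_cmod by (auto simp: abs_le_iff) (smt (verit) abs_Re_le_cmod)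
    show "G z = F z" if "z \<in> ball 0 (min 1 \<rho>)" for z
      using that sG[of z] near[of z] by (auto intro: sums_unique2)
  qed (use \<rho> opn that G_hol hol in \<open>auto simp: S_def intro: holomorphic_on_subset\<close>)
  have "isCont F 1"
    using holomorphic_on_imp_continuous_on[OF hol] opn \<rho> by (simp add: continuous_on_eq_continuous_at)
  then have "((\<lambda>r. F (of_real r)) \<longlongrightarrow> F 1) (at_left (1::real))"
    by (rule isCont_tendsto_compose) (intro tendsto_eq_intros; simp)
  moreover have "\<forall>\<^sub>F r in at_left (1::real). F (of_real r) = G (of_real r)"
    by (rule eventually_at_leftI[of 0]) (use \<rho> in \<open>auto simp: eq S_def\<close>)
  ultimately have "((\<lambda>r. G (of_real r)) \<longlongrightarrow> F 1) (at_left (1::real))"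
    by (rule Lim_transform_eventually)
  with Abel_limit[OF d] show ?thesis
    unfolding G_def by (rule tendsto_unique[rotated]) simp
qed

section \<open>Iterated derivatives of monomials and of the binomial\<close>

text \<open>
  The \<open>k\<close>-th derivative of \<open>t ^ p\<close>. The recursion differentiates first and then takes the remaining
  derivatives, so that inductions over \<open>k\<close> run with \<open>p\<close> arbitrary.
\<close>
fun power_jet :: "nat \<Rightarrow> nat \<Rightarrow> 'a::real_normed_field \<Rightarrow> 'a" where
  "power_jet 0 p t = t ^ p"
| "power_jet (Suc k) p t = of_nat p * power_jet k (p - 1) t"

text \<open>
  The \<open>k\<close>-th derivative with respect to \<open>t\<close> of \<open>s ^ j * t ^ i * (1 + s * t\<^sup>2 / 2) powr b\<close>. The powers
  of \<open>s\<close> and \<open>t\<close> in front make the family closed under differentiation in \<open>t\<close>, so that properties of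
  all derivatives follow by induction on \<open>k\<close> from those of the family itself.
\<close>
fun binom_jet :: "nat \<Rightarrow> complex \<Rightarrow> nat \<Rightarrow> nat \<Rightarrow> complex \<Rightarrow> real \<Rightarrow> complex" where
  "binom_jet 0 b i j s t = s ^ j * of_real t ^ i * (1 + s * of_real (t\<^sup>2 / 2)) powr b"
| "binom_jet (Suc k) b i j s t =
     of_nat i * binom_jet k b (i - 1) j s t + b * binom_jet k (b - 1) (i + 1) (j + 1) s t"

lemma power_jet_has_derivative:
  "((\<lambda>t. power_jet k p t) has_field_derivative power_jet (Suc k) p t) (at t)"
proof (induction k arbitrary: p)
  case 0
  show ?case by (auto intro!: derivative_eq_intros)
next
  case (Suc k)
  from DERIV_cmult[OF this, of "of_nat p" "p - 1"] show ?case by simp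
qed

lemma power_jet_continuous [continuous_intros]:
  "continuous_on A f \<Longrightarrow> continuous_on A (\<lambda>x. power_jet k p (f x))"
  by (induction k arbitrary: p) (auto intro!: continuous_intros)

lemma power_jet_closed_form:
  "power_jet k p t = (if k \<le> p then fact p / fact (p - k) * t ^ (p - k) else 0)"
proof (induction k arbitrary: p)
  case (Suc k)
  show ?case
    by (cases p) (auto simp: Suc)
qed auto

text \<open>
  A monomial with nonnegative coefficient is largest at the right end of \<open>{- M..M}\<close>; this makes the
  value at \<open>M\<close> a majorant for the Weierstrass test.
\<close>
lemma power_jet_abs_le:
  fixes t M :: real
  assumes "\<bar>t\<bar> \<le> M"
  shows "\<bar>power_jet k p t\<bar> \<le> power_jet k p M"
  using assms by (auto simp: power_jet_closed_form abs_mult power_abs divide_right_mono power_mono)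

lemma halfplane_binomial_base:
  assumes "Re s > - (2 / M\<^sup>2)" and "\<bar>t\<bar> \<le> M"
  shows "Re (1 + s * of_real (t\<^sup>2 / 2)) > 0"
proof (cases "t = 0")
  case False
  then have M: "M > 0" using assms by linarith
  have "t\<^sup>2 \<le> M\<^sup>2" using assms(2) M by (simp add: abs_le_square_iff [symmetric])
  then have "2 / M\<^sup>2 \<le> 2 / t\<^sup>2" using False M by (intro divide_left_mono) auto
  then have "- (2 / t\<^sup>2) < Re s" using assms by linarith
  then have "- (2 / t\<^sup>2) * t\<^sup>2 < Re s * t\<^sup>2" using False by (intro mult_strict_right_mono) auto
  then show ?thesis using False by (simp add: field_simps)
qed auto

lemma binom_jet_continuous:
  fixes \<beta> \<sigma> :: "'p::topological_space \<Rightarrow> complex" and \<tau> :: "'p \<Rightarrow> real"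
  assumes "continuous_on P \<beta>" "continuous_on P \<sigma>" "continuous_on P \<tau>"
    and pos: "\<And>p. p \<in> P \<Longrightarrow> Re (1 + \<sigma> p * of_real ((\<tau> p)\<^sup>2 / 2)) > 0"
  shows "continuous_on P (\<lambda>p. binom_jet k (\<beta> p) i j (\<sigma> p) (\<tau> p))"
  using assms(1)
proof (induction k arbitrary: \<beta> i j)
  case 0
  show ?case unfolding binom_jet.simps
  proof (intro continuous_intros 0 assms(2,3))
    show "P \<subseteq> {z. 0 \<le> Re (1 + \<sigma> z * complex_of_real ((\<tau> z)\<^sup>2 / 2)) \<or> Im (1 + \<sigma> z * complex_of_real ((\<tau> z)\<^sup>2 / 2)) \<noteq> 0}"
      using pos by (force intro: less_imp_le)
    show "0 < Re (\<beta> z)" if "z \<in> P" "1 + \<sigma> z * complex_of_real ((\<tau> z)\<^sup>2 / 2) = 0" for z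
      using pos[OF that(1)] unfolding that(2) by simp
  qed auto
next
  case (Suc k)
  show ?case unfolding binom_jet.simps
    by (intro continuous_intros Suc)
qed

lemma binom_jet_has_vector_derivative:
  assumes "Re (1 + s * of_real (t\<^sup>2 / 2)) > 0"
  shows "(binom_jet k b i j s has_vector_derivative binom_jet (Suc k) b i j s t) (at t)"
proof (induction k arbitrary: b i j)
  case 0
  define w where "w = 1 + s * of_real (t\<^sup>2 / 2)"
  have "Re w > 0" using assms by (simp only: w_def)
  then have w: "w \<notin> \<real>\<^sub>\<le>\<^sub>0" "w \<noteq> 0" by (auto simp: complex_nonpos_Reals_iff)
  have "((\<lambda>z. s ^ j * z ^ i * (1 + s * (z\<^sup>2 / 2)) powr b) has_field_derivative
      binom_jet (Suc 0) b i j s t) (at (of_real t))"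
    using w unfolding w_def
    by (auto intro!: derivative_eq_intros simp: powr_diff field_simps power2_eq_square)
  from has_vector_derivative_real_field[OF this] show ?case
    by (simp add: fun_eq_iff o_def)
next
  case (Suc k)
  show ?case
    unfolding binom_jet.simps(2)[of "Suc k"]
    by (auto intro!: derivative_eq_intros Suc simp: fun_eq_iff)
qed

text \<open>
  The derivative in \<open>s\<close> stays in the same family, which is why it is continuous in \<open>(s, t)\<close> and why
  integrals over \<open>t\<close> may be differentiated in \<open>s\<close>.
\<close>
lemma binom_jet_has_field_derivative_param:
  assumes "Re (1 + s * of_real (t\<^sup>2 / 2)) > 0"
  shows "((\<lambda>s. binom_jet k b i j s t) has_field_derivative
    of_nat j * binom_jet k b i (j - 1) s t + b / 2 * binom_jet k (b - 1) (i + 2) j s t) (at s)"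
proof (induction k arbitrary: b i j)
  case 0
  define w where "w = 1 + s * of_real (t\<^sup>2 / 2)"
  have "Re w > 0" using assms by (simp only: w_def)
  then have w: "w \<notin> \<real>\<^sub>\<le>\<^sub>0" "w \<noteq> 0" by (auto simp: complex_nonpos_Reals_iff)
  show ?case
    using w unfolding w_def
    by (auto intro!: derivative_eq_intros simp: powr_diff field_simps power2_eq_square)
next
  case (Suc k)
  show ?case unfolding binom_jet.simps(2)
    by (rule DERIV_cong[OF DERIV_add[OF DERIV_cmult[OF Suc] DERIV_cmult[OF Suc]]])
       (cases i; cases j; simp add: field_simps)
qed

text \<open>
  The binomial series may be differentiated term by term in \<open>t\<close>. Instead of an exchange of limits this
  is an induction along the recursion of \<open>binom_jet\<close>: with the absorption identity
  \<open>n * (b gchoose n) = b * (b - 1 gchoose n - 1)\<close> the series of the two summands, one of them shifted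
  by one index, add up to the derivative \<open>(2 n + i) * t ^ (2 n + i - 1)\<close> in every term.
\<close>
lemma binom_jet_sums:
  assumes s: "norm s < 2 / M\<^sup>2" and t: "\<bar>t\<bar> \<le> M"
  shows "(\<lambda>n. (b gchoose n) / 2 ^ n * s ^ (n + j) * of_real (power_jet k (2 * n + i) t)) sums binom_jet k b i j s t"
proof (induction k arbitrary: b i j)
  case 0
  have "norm (s * of_real (t\<^sup>2 / 2)) < 1"
  proof (cases "t = 0")
    case False
    then have M: "M > 0" using t by linarith
    have "t\<^sup>2 \<le> M\<^sup>2" using t M by (simp add: abs_le_square_iff [symmetric])
    then have "2 / M\<^sup>2 \<le> 2 / t\<^sup>2" using False M by (intro divide_left_mono) auto
    then have "norm s < 2 / t\<^sup>2" using s by linarith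
    then show ?thesis using False by (simp add: norm_mult norm_divide norm_power field_simps)
  qed auto
  from sums_mult[OF gen_binomial_complex[OF this, of b], of "s ^ j * of_real t ^ i"] show ?case
    by (simp add: power_mult_distrib power_divide power_add power_mult mult_ac power2_eq_square)
next
  case (Suc k)
  define c where "c n = of_nat (2 * n) * (b gchoose n) / 2 ^ n * s ^ (n + j) * of_real (power_jet k (2 * n + i - 1) t)" for n
  have "(\<lambda>n. b * ((b - 1 gchoose n) / 2 ^ n * s ^ (n + (j + 1)) * of_real (power_jet k (2 * n + (i + 1)) t)))
     sums (b * binom_jet k (b - 1) (i + 1) (j + 1) s t)"
    by (intro sums_mult Suc)
  also have "(\<lambda>n. b * ((b - 1 gchoose n) / 2 ^ n * s ^ (n + (j + 1)) * of_real (power_jet k (2 * n + (i + 1)) t)))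
      = (\<lambda>n. c (Suc n))"
  proof
    fix n
    have "of_nat (Suc n) * (b gchoose Suc n) = b * (b - 1 gchoose n)"
      using gbinomial_absorption[of n "b"] by simp
    moreover have "c (Suc n) = 2 * (of_nat (Suc n) * (b gchoose Suc n)) / 2 ^ Suc n * s ^ (Suc n + j) * of_real (power_jet k (2 * n + i + 1) t)"
      unfolding c_def by (simp only: of_nat_mult of_nat_numeral mult.assoc) simp
    ultimately have "c (Suc n) = 2 * (b * (b - 1 gchoose n)) / 2 ^ Suc n * s ^ (Suc n + j) * of_real (power_jet k (2 * n + i + 1) t)"
      by (simp only:)
    then show "b * ((b - 1 gchoose n) / 2 ^ n * s ^ (n + (j + 1)) * of_real (power_jet k (2 * n + (i + 1)) t)) = c (Suc n)"
      by simp
  qed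
  finally have A: "c sums (b * binom_jet k (b - 1) (i + 1) (j + 1) s t)"
    by (subst (asm) sums_Suc_iff) (simp add: c_def)
  have B: "(\<lambda>n. of_nat i * ((b gchoose n) / 2 ^ n * s ^ (n + j) * of_real (power_jet k (2 * n + (i - 1)) t)))
     sums (of_nat i * binom_jet k b (i - 1) j s t)"
    by (intro sums_mult Suc)
  show ?case unfolding binom_jet.simps(2)
  proof (rule sums_cong[THEN iffD2, OF _ sums_add[OF B A]])
    fix n show "(b gchoose n) / 2 ^ n * s ^ (n + j) * of_real (power_jet (Suc k) (2 * n + i) t) =
      of_nat i * ((b gchoose n) / 2 ^ n * s ^ (n + j) * of_real (power_jet k (2 * n + (i - 1)) t)) + c n"
      by (cases i) (auto simp: c_def field_simps)
  qed
qed

text \<open>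
  The series at \<open>t = M\<close> is a power series in \<open>s\<close> which converges on the whole disc, hence absolutely
  on it.
\<close>
lemma binom_jet_majorant_summable:
  fixes b s :: complex
  assumes s: "norm s < 2 / M\<^sup>2" and M: "M > 0"
  shows "summable (\<lambda>n. norm ((b gchoose n) / 2 ^ n * s ^ n) * power_jet k (2 * n) M)"
proof -
  obtain r where r: "norm s < r" "r < 2 / M\<^sup>2" using dense[OF s] by auto
  have r0: "norm (of_real r :: complex) = r" using r order.trans[OF norm_ge_zero[of s] less_imp_le[OF r(1)]] by simp
  have "summable (\<lambda>n. (b gchoose n) / 2 ^ n * of_real (power_jet k (2 * n) M) * of_real r ^ n)"
    using sums_summable[OF binom_jet_sums[of "of_real r" M M b 0 k 0]] r r0 M by (simp add: mult_ac)
  from powser_insidea[OF this, of s] r r0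
  have "summable (\<lambda>n. norm ((b gchoose n) / 2 ^ n * of_real (power_jet k (2 * n) M) * s ^ n))" by simp
  moreover have "0 \<le> power_jet k (2 * n) M" for n
    using M by (simp add: power_jet_closed_form)
  ultimately show ?thesis by (simp add: norm_mult norm_divide norm_power mult_ac)
qed

lemma binom_jet_at_1:
  "binom_jet 0 (of_real b) 0 0 1 t = of_real ((1 + t\<^sup>2 / 2) powr b)"
proof -
  have "0 \<le> 1 + t\<^sup>2 / 2" by simp
  from powr_of_real[OF this, of b] show ?thesis by simp
qed

section \<open>The Abel kernel as an integral over a continuous integrand\<close>

text \<open>
  With \<open>v = ((y - t) / (y - a)) powr \<mu>\<close>, the relative position \<open>(t - a) / (y - a)\<close> of \<open>t\<close> in
  \<open>{a..y}\<close> is \<open>abel_shift \<mu> v\<close>; this substitution absorbs the kernel \<open>(y - t) powr (\<mu> - 1)\<close>.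
\<close>
definition abel_shift :: "real \<Rightarrow> real \<Rightarrow> real" where
  "abel_shift \<mu> v = 1 - v powr (1 / \<mu>)"

text \<open>
  For a sequence \<open>H\<close> in which \<open>H (k + 1)\<close> is the derivative of \<open>H k\<close>, this is the \<open>j\<close>-th derivative
  with respect to \<open>y\<close> of \<open>(y - a) powr \<nu> / \<mu>\<close> times the integral of
  \<open>abel_shift \<mu> v ^ k * H k (a + (y - a) * abel_shift \<mu> v)\<close> over \<open>v\<close>: differentiating the power lowers
  \<open>\<nu>\<close>, and differentiating the integrand raises \<open>k\<close>. Written in this form, the \<open>j\<close>-th derivative is
  visibly a linear functional of \<open>H\<close> that is compatible with series and with parameters.
\<close>
fun rl_jet :: "real \<Rightarrow> real \<Rightarrow> (nat \<Rightarrow> real \<Rightarrow> 'a::euclidean_space) \<Rightarrow> nat \<Rightarrow> real \<Rightarrow> nat \<Rightarrow> real \<Rightarrow> 'a" where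
  "rl_jet \<mu> a H 0 \<nu> k y =
     ((y - a) powr \<nu> / \<mu>) *\<^sub>R
       integral {0..1} (\<lambda>v. abel_shift \<mu> v ^ k *\<^sub>R H k (a + (y - a) * abel_shift \<mu> v))"
| "rl_jet \<mu> a H (Suc j) \<nu> k y = \<nu> *\<^sub>R rl_jet \<mu> a H j (\<nu> - 1) k y + rl_jet \<mu> a H j \<nu> (Suc k) y"

lemma abel_shift_range: "\<mu> > 0 \<Longrightarrow> v \<in> {0..1} \<Longrightarrow> abel_shift \<mu> v \<in> {0..1}"
  by (auto simp: abel_shift_def powr_le_one_le intro: powr_mono2[of "1 / \<mu>" v 1, simplified])

lemma abel_shift_segment:
  assumes "\<mu> > 0" "a \<le> y" "v \<in> {0..1}"
  shows "a + (y - a) * abel_shift \<mu> v \<in> {a..y}"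
  using abel_shift_range[OF assms(1,3)] assms(2) mult_left_le[of "abel_shift \<mu> v" "y - a"] by auto

lemma abel_shift_continuous [continuous_intros]:
  assumes "\<mu> > 0" "continuous_on A f" "\<And>x. x \<in> A \<Longrightarrow> f x \<in> {0..1}"
  shows "continuous_on A (\<lambda>x. abel_shift \<mu> (f x))"
  unfolding abel_shift_def using assms by (intro continuous_intros continuous_on_powr') auto

text \<open>
  The substitution is applied from \<open>{a..y}\<close> to \<open>{0..1}\<close>, in the direction where its derivative is a
  multiple of the kernel; for \<open>\<mu> < 1\<close> it is not differentiable at \<open>t = y\<close>, which is a finite
  exceptional set.
\<close>
lemma rl_kernel_has_integral:
  fixes g :: "real \<Rightarrow> 'a::euclidean_space"
  assumes \<mu>: "\<mu> > 0" and y: "a < y" and g: "continuous_on {a..y} g"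
  shows "((\<lambda>t. (y - t) powr (\<mu> - 1) *\<^sub>R g t) has_integral
    ((y - a) powr \<mu> / \<mu>) *\<^sub>R integral {0..1} (\<lambda>v. g (a + (y - a) * abel_shift \<mu> v))) {a..y}"
proof -
  define G where "G v = g (a + (y - a) * abel_shift \<mu> v)" for v
  define u where "u t = ((y - t) / (y - a)) powr \<mu>" for t
  define u' where "u' t = - (\<mu> / (y - a) powr \<mu>) * (y - t) powr (\<mu> - 1)" for t
  have contG: "continuous_on {0..1} G"
    unfolding G_def using abel_shift_segment[of \<mu> a y] \<mu> y
    by (intro continuous_on_compose2[OF g] continuous_intros) auto
  have contu: "continuous_on {a..y} u"
    unfolding u_def using \<mu> y by (intro continuous_on_powr' continuous_intros) auto
  have range: "u ` {a..y} \<subseteq> {0..1}"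
    using \<mu> y by (auto simp: u_def intro!: powr_le1)
  have der: "(u has_field_derivative u' t) (at t within {a..y})" if "t \<in> {a..y} - {y}" for t
  proof -
    have "(u has_field_derivative \<mu> * ((y - t) / (y - a)) powr (\<mu> - 1) * (- 1 / (y - a))) (at t within {a..y})"
      unfolding u_def using that y
      by (intro has_field_derivative_at_within[OF DERIV_fun_powr[where r = \<mu>, simplified]])
         (auto intro!: derivative_eq_intros simp: divide_simps)
    moreover have "\<mu> * ((y - t) / (y - a)) powr (\<mu> - 1) * (- 1 / (y - a)) = u' t"
      using that y by (simp add: u'_def powr_divide powr_diff)
    ultimately show ?thesis by simp
  qed
  have "((\<lambda>t. u' t *\<^sub>R G (u t)) has_integral (integral {u a..u y} G - integral {u y..u a} G)) {a..y}"
    by (rule has_integral_substitution_general[where s = "{y}"])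
       (use y range contG contu der in auto)
  moreover have "u a = 1" "u y = 0" using y by (auto simp: u_def)
  ultimately have "((\<lambda>t. u' t *\<^sub>R G (u t)) has_integral - integral {0..1} G) {a..y}" by simp
  from has_integral_cmul[OF this, of "- ((y - a) powr \<mu> / \<mu>)"]
  have "((\<lambda>t. (- ((y - a) powr \<mu> / \<mu>) * u' t) *\<^sub>R G (u t)) has_integral
     ((y - a) powr \<mu> / \<mu>) *\<^sub>R integral {0..1} G) {a..y}" by simp
  moreover have "(- ((y - a) powr \<mu> / \<mu>) * u' t) *\<^sub>R G (u t) = (y - t) powr (\<mu> - 1) *\<^sub>R g t"
    if "t \<in> {a..y}" for t
  proof -
    have "abel_shift \<mu> (u t) = 1 - (y - t) / (y - a)"
      using that y \<mu> by (simp add: abel_shift_def u_def powr_powr)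
    then have "a + (y - a) * abel_shift \<mu> (u t) = t" using y by (simp add: field_simps)
    then have "G (u t) = g t" by (simp add: G_def)
    moreover have "- ((y - a) powr \<mu> / \<mu>) * u' t = (y - t) powr (\<mu> - 1)"
      using y \<mu> by (simp add: u'_def)
    ultimately show ?thesis by simp
  qed
  ultimately show ?thesis unfolding G_def
    by (rule has_integral_eq[rotated]) blast
qed

lemma rl_jet_0_eq_integral:
  assumes "\<mu> > 0" "a < y" "continuous_on {a..y} (H 0)"
  shows "integral {a..y} (\<lambda>t. (y - t) powr (\<mu> - 1) *\<^sub>R H 0 t) = rl_jet \<mu> a H 0 \<mu> 0 y"
  using integral_unique[OF rl_kernel_has_integral[OF assms]] by simp

lemma rl_integrand_integrable:
  fixes g :: "real \<Rightarrow> 'a::euclidean_space"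
  assumes "\<mu> > 0" "a \<le> y" "continuous_on {a..y} g"
  shows "(\<lambda>v. abel_shift \<mu> v ^ k *\<^sub>R g (a + (y - a) * abel_shift \<mu> v)) integrable_on {0..1}"
  using assms abel_shift_segment[of \<mu> a y]
  by (intro integrable_continuous_real continuous_intros continuous_on_compose2[OF assms(3)]) auto

lemma rl_jet_has_vector_derivative:
  assumes \<mu>: "\<mu> > 0" and y: "a < y"
    and H: "\<And>k t. (H k has_vector_derivative H (Suc k) t) (at t)"
  shows "(rl_jet \<mu> a H j \<nu> k has_vector_derivative rl_jet \<mu> a H (Suc j) \<nu> k y) (at y)"
  using y
proof (induction j arbitrary: \<nu> k)
  case 0
  have contH [continuous_intros]: "continuous_on A f \<Longrightarrow> continuous_on A (\<lambda>x. H k (f x))"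
    for A :: "'c::topological_space set" and f k
    by (rule continuous_on_compose2[of UNIV])
       (auto intro!: continuous_at_imp_continuous_on has_vector_derivative_continuous[OF H])
  define I where "I k y = integral {0..1} (\<lambda>v. abel_shift \<mu> v ^ k *\<^sub>R H k (a + (y - a) * abel_shift \<mu> v))" for k y
  have I: "(I k has_vector_derivative I (Suc k) y) (at y)" for k
  proof -
    have "((\<lambda>y. integral (cbox 0 1) (\<lambda>v. abel_shift \<mu> v ^ k *\<^sub>R H k (a + (y - a) * abel_shift \<mu> v)))
       has_vector_derivative
       integral (cbox 0 1) (\<lambda>v. abel_shift \<mu> v ^ Suc k *\<^sub>R H (Suc k) (a + (y - a) * abel_shift \<mu> v))) (at y within UNIV)"
    proof (rule leibniz_rule_vector_derivative)
      fix z v :: real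
      have "((\<lambda>z. H k (a + (z - a) * abel_shift \<mu> v)) has_vector_derivative
         abel_shift \<mu> v *\<^sub>R H (Suc k) (a + (z - a) * abel_shift \<mu> v)) (at z)"
        by (rule vector_diff_chain_at[of "\<lambda>z. a + (z - a) * abel_shift \<mu> v", unfolded o_def])
           (auto intro!: derivative_eq_intros H)
      from has_vector_derivative_scaleR[OF DERIV_const this, of "abel_shift \<mu> v ^ k"]
      show "((\<lambda>y. abel_shift \<mu> v ^ k *\<^sub>R H k (a + (y - a) * abel_shift \<mu> v)) has_vector_derivative
         abel_shift \<mu> v ^ Suc k *\<^sub>R H (Suc k) (a + (z - a) * abel_shift \<mu> v)) (at z within UNIV)"
        by (simp add: mult_ac)
    next
      show "(\<lambda>v. abel_shift \<mu> v ^ k *\<^sub>R H k (a + (z - a) * abel_shift \<mu> v)) integrable_on cbox 0 1" for z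
        using \<mu> by (intro integrable_continuous continuous_intros) auto
      show "continuous_on (UNIV \<times> cbox 0 1)
         (\<lambda>(z, v). abel_shift \<mu> v ^ Suc k *\<^sub>R H (Suc k) (a + (z - a) * abel_shift \<mu> v))"
        unfolding case_prod_beta using \<mu> by (intro continuous_intros) auto
    qed auto
    then show ?thesis by (simp add: I_def[abs_def])
  qed
  have P: "((\<lambda>y. (y - a) powr \<nu> / \<mu>) has_field_derivative \<nu> * (y - a) powr (\<nu> - 1) / \<mu>) (at y)"
    using 0 \<mu> by (auto intro!: derivative_eq_intros)
  have eq: "rl_jet \<mu> a H 0 \<nu> k = (\<lambda>y. ((y - a) powr \<nu> / \<mu>) *\<^sub>R I k y)"
    by (simp add: fun_eq_iff I_def)
  from has_vector_derivative_scaleR[OF P I[of k]] show ?case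
    unfolding eq by (simp add: I_def add_ac)
next
  case (Suc j)
  have "((\<lambda>y. \<nu> *\<^sub>R rl_jet \<mu> a H j (\<nu> - 1) k y + rl_jet \<mu> a H j \<nu> (Suc k) y) has_vector_derivative
      \<nu> *\<^sub>R rl_jet \<mu> a H (Suc j) (\<nu> - 1) k y + rl_jet \<mu> a H (Suc j) \<nu> (Suc k) y) (at y)"
    using has_vector_derivative_scaleR[OF DERIV_const Suc.IH[OF Suc.prems], of \<nu> "\<nu> - 1" k]
    by (intro has_vector_derivative_add Suc) (simp del: rl_jet.simps)
  moreover have "rl_jet \<mu> a H (Suc j) \<nu> k = (\<lambda>y. \<nu> *\<^sub>R rl_jet \<mu> a H j (\<nu> - 1) k y + rl_jet \<mu> a H j \<nu> (Suc k) y)"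
    by (simp add: fun_eq_iff)
  ultimately show ?case
    by (simp only: rl_jet.simps(2)[of \<mu> a H "Suc j" \<nu> k y])
qed

lemma rl_jet_linear:
  assumes "\<mu> > 0" "a \<le> y" "\<And>k. continuous_on {a..y} (H k)" "bounded_linear L"
  shows "rl_jet \<mu> a (\<lambda>k t. L (H k t)) j \<nu> k y = L (rl_jet \<mu> a H j \<nu> k y)"
proof (induction j arbitrary: \<nu> k)
  case 0
  have "integral {0..1} (L \<circ> (\<lambda>v. abel_shift \<mu> v ^ k *\<^sub>R H k (a + (y - a) * abel_shift \<mu> v)))
     = L (integral {0..1} (\<lambda>v. abel_shift \<mu> v ^ k *\<^sub>R H k (a + (y - a) * abel_shift \<mu> v)))"
    by (intro integral_linear rl_integrand_integrable assms)
  then show ?case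
    by (simp add: o_def linear_scale[OF bounded_linear.linear[OF assms(4)]])
next
  case (Suc j)
  then show ?case
    by (simp add: linear_scale[OF bounded_linear.linear[OF assms(4)]] linear_add[OF bounded_linear.linear[OF assms(4)]])
qed

text \<open>
  The shift has values in \<open>{0..1}\<close>, so a majorant for the functions \<open>h n k\<close> is one for the integrands,
  and the Weierstrass test allows summation under the integral.
\<close>
lemma rl_jet_sums:
  assumes \<mu>: "\<mu> > 0" and y: "a \<le> y"
    and cont: "\<And>n k. continuous_on {a..y} (h n k)"
    and sums: "\<And>k t. t \<in> {a..y} \<Longrightarrow> (\<lambda>n. h n k t) sums H k t"
    and bound: "\<And>n k t. t \<in> {a..y} \<Longrightarrow> norm (h n k t) \<le> B k n" and B: "\<And>k. summable (B k)"
  shows "(\<lambda>n. rl_jet \<mu> a (h n) j \<nu> k y) sums rl_jet \<mu> a H j \<nu> k y"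
proof (induction j arbitrary: \<nu> k)
  case 0
  define g where "g n v = abel_shift \<mu> v ^ k *\<^sub>R h n k (a + (y - a) * abel_shift \<mu> v)" for n v
  define G where "G v = abel_shift \<mu> v ^ k *\<^sub>R H k (a + (y - a) * abel_shift \<mu> v)" for v
  have g_sums: "(\<lambda>n. g n v) sums G v" if "v \<in> {0..1}" for v
    unfolding g_def G_def by (intro sums_scaleR_right sums abel_shift_segment \<mu> y that)
  have g_int: "g n integrable_on {0..1}" for n
    unfolding g_def by (intro rl_integrand_integrable \<mu> y cont)
  have g_cont: "continuous_on {0..1} (g n)" for n
    unfolding g_def using \<mu> y abel_shift_segment[of \<mu> a y]
    by (intro continuous_intros continuous_on_compose2[OF cont]) auto
  have "uniform_limit {0..1} (\<lambda>n v. \<Sum>i<n. g i v) (\<lambda>v. \<Sum>i. g i v) sequentially"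
  proof (rule Weierstrass_m_test[OF _ B])
    fix n and v :: real assume v: "v \<in> {0..1}"
    have "norm (g n v) = abel_shift \<mu> v ^ k * norm (h n k (a + (y - a) * abel_shift \<mu> v))"
      using abel_shift_range[OF \<mu> v] by (simp add: g_def)
    also have "\<dots> \<le> 1 * B k n"
      using abel_shift_range[OF \<mu> v] bound[OF abel_shift_segment[OF \<mu> y v]]
      by (intro mult_mono power_le_one) auto
    finally show "norm (g n v) \<le> B k n" by simp
  qed
  also have "?this \<longleftrightarrow> uniform_limit {0..1} (\<lambda>n v. \<Sum>i<n. g i v) G sequentially"
    using g_sums by (intro uniform_limit_cong') (auto simp: sums_iff)
  finally obtain I J where IJ: "\<And>n. ((\<lambda>v. \<Sum>i<n. g i v) has_integral I n) {0..1}"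
      "(G has_integral J) {0..1}" "I \<longlonglongrightarrow> J"
    by (rule uniform_limit_integral) (auto intro!: continuous_intros g_cont)
  have "I = (\<lambda>n. \<Sum>i<n. integral {0..1} (g i))"
    using has_integral_unique[OF IJ(1) has_integral_sum[OF _ integrable_integral[OF g_int]]] by auto
  then have "(\<lambda>n. integral {0..1} (g n)) sums integral {0..1} G"
    using IJ by (auto simp: sums_def dest: integral_unique)
  then show ?case
    unfolding rl_jet.simps by (intro sums_scaleR_right) (simp add: g_def[abs_def] G_def[abs_def])
next
  case (Suc j)
  show ?case unfolding rl_jet.simps(2)
    by (intro sums_add sums_scaleR_right Suc)
qed

lemma rl_jet_continuous_param:
  fixes H :: "'p::topological_space \<Rightarrow> nat \<Rightarrow> real \<Rightarrow> 'a::euclidean_space"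
  assumes \<mu>: "\<mu> > 0" and y: "a \<le> y"
    and H: "\<And>k. continuous_on (U \<times> {a..y}) (\<lambda>(p, t). H p k t)"
  shows "continuous_on U (\<lambda>p. rl_jet \<mu> a (H p) j \<nu> k y)"
proof (induction j arbitrary: \<nu> k)
  case 0
  have "continuous_on (U \<times> cbox 0 1) (\<lambda>(p, v). abel_shift \<mu> v ^ k *\<^sub>R H p k (a + (y - a) * abel_shift \<mu> v))"
    unfolding case_prod_beta using \<mu> abel_shift_segment[OF \<mu> y]
    by (intro continuous_intros continuous_on_compose2[OF H[of k], where f = "\<lambda>z. (fst z, a + (y - a) * abel_shift \<mu> (snd z))", unfolded case_prod_beta fst_conv snd_conv])
       auto
  from integral_continuous_on_param[OF this] show ?case
    by (auto intro!: continuous_intros)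
next
  case (Suc j)
  show ?case unfolding rl_jet.simps(2) by (intro continuous_intros Suc)
qed

lemma rl_jet_holomorphic_param:
  fixes H :: "complex \<Rightarrow> nat \<Rightarrow> real \<Rightarrow> complex"
  assumes \<mu>: "\<mu> > 0" and y: "a \<le> y" and U: "convex U" 
    and H: "\<And>k. continuous_on (U \<times> {a..y}) (\<lambda>(s, t). H s k t)"
    and H': "\<And>k. continuous_on (U \<times> {a..y}) (\<lambda>(s, t). H' s k t)"
    and der: "\<And>k s t. s \<in> U \<Longrightarrow> t \<in> {a..y} \<Longrightarrow> ((\<lambda>s. H s k t) has_field_derivative H' s k t) (at s)"
  shows "(\<lambda>s. rl_jet \<mu> a (H s) j \<nu> k y) holomorphic_on U"
proof (induction j arbitrary: \<nu> k)
  case 0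
  have "(\<lambda>s. integral (cbox 0 1) (\<lambda>v. abel_shift \<mu> v ^ k *\<^sub>R H s k (a + (y - a) * abel_shift \<mu> v))) holomorphic_on U"
  proof (rule leibniz_rule_holomorphic[OF _ _ _ U])
    fix s and v :: real assume "s \<in> U" "v \<in> cbox 0 1"
    then show "((\<lambda>s. abel_shift \<mu> v ^ k *\<^sub>R H s k (a + (y - a) * abel_shift \<mu> v)) has_field_derivative
       abel_shift \<mu> v ^ k *\<^sub>R H' s k (a + (y - a) * abel_shift \<mu> v)) (at s within U)"
      unfolding scaleR_conv_of_real using abel_shift_segment[OF \<mu> y]
      by (intro DERIV_cmult has_field_derivative_at_within[OF der]) auto
  next
    fix s assume s: "s \<in> U"
    have "continuous_on {a..y} (H s k)"
      using s by (intro continuous_on_compose2[OF H[of k], where f = "\<lambda>t. (s, t)", unfolded case_prod_beta fst_conv snd_conv] continuous_intros) auto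
    from rl_integrand_integrable[OF \<mu> y this]
    show "(\<lambda>v. abel_shift \<mu> v ^ k *\<^sub>R H s k (a + (y - a) * abel_shift \<mu> v)) integrable_on cbox 0 1"
      by simp
  next
    show "continuous_on (U \<times> cbox 0 1) (\<lambda>(s, v). abel_shift \<mu> v ^ k *\<^sub>R H' s k (a + (y - a) * abel_shift \<mu> v))"
      unfolding case_prod_beta using \<mu> abel_shift_segment[OF \<mu> y]
      by (intro continuous_intros continuous_on_compose2[OF H'[of k], where f = "\<lambda>z. (fst z, a + (y - a) * abel_shift \<mu> (snd z))", unfolded case_prod_beta fst_conv snd_conv])
         auto
  qed
  then show ?case
    by (auto intro!: holomorphic_intros simp: scaleR_conv_of_real)
next
  case (Suc j)
  show ?case unfolding rl_jet.simps(2) scaleR_conv_of_real by (intro holomorphic_intros Suc)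
qed

text \<open>
  The equality with \<open>g\<close> has to hold on an open set because \<open>deriv\<close> at a point depends on nearby
  values.
\<close>
lemma iterated_deriv_eqI:
  fixes g :: "nat \<Rightarrow> real \<Rightarrow> real"
  assumes S: "open S" and f: "\<And>y. y \<in> S \<Longrightarrow> f y = g 0 y"
    and der: "\<And>j y. y \<in> S \<Longrightarrow> (g j has_field_derivative g (Suc j) y) (at y)"
    and y: "y \<in> S"
  shows "(deriv ^^ j) f y = g j y"
  using y
proof (induction j arbitrary: y)
  case (Suc j)
  have "eventually (\<lambda>z. z \<in> S) (nhds y)" using S Suc.prems by (rule eventually_nhds_in_open)
  then have "eventually (\<lambda>z. (deriv ^^ j) f z = g j z) (nhds y)"
    by eventually_elim (rule Suc.IH)
  then have "deriv ((deriv ^^ j) f) y = deriv (g j) y" by (rule deriv_cong_ev) simp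
  then show ?case using DERIV_imp_deriv[OF der[OF Suc.prems]] by simp
qed (use f in simp)

section \<open>Fractional integrals and derivatives of monomials\<close>

text \<open>
  The left-hand side involves \<open>deriv\<close> and an integral over a varying interval with a singular kernel;
  \<open>rl_jet\<close> is its value in a form that passes to limits.
\<close>
lemma iterated_deriv_rl_kernel:
  fixes g :: "nat \<Rightarrow> real \<Rightarrow> real"
  assumes \<mu>: "\<mu> > 0" and x: "a < x"
    and g: "\<And>k t. (g k has_field_derivative g (Suc k) t) (at t)"
  shows "(deriv ^^ j) (\<lambda>y. integral {a..y} (\<lambda>t. (y - t) powr (\<mu> - 1) * g 0 t)) x = rl_jet \<mu> a g j \<mu> 0 x"
proof (rule iterated_deriv_eqI[where S = "{a<..}" and g = "\<lambda>j y. rl_jet \<mu> a g j \<mu> 0 y"])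
  have "continuous_on {a..y} (g 0)" for y
    using g by (intro continuous_at_imp_continuous_on) (auto intro: DERIV_isCont)
  then show "integral {a..y} (\<lambda>t. (y - t) powr (\<mu> - 1) * g 0 t) = rl_jet \<mu> a g 0 \<mu> 0 y" if "y \<in> {a<..}" for y
    using rl_jet_0_eq_integral[of \<mu> a y g] \<mu> that by simp
  show "(rl_jet \<mu> a g j \<mu> 0 has_field_derivative rl_jet \<mu> a g (Suc j) \<mu> 0 y) (at y)" if "y \<in> {a<..}" for j y
    using rl_jet_has_vector_derivative[OF \<mu>, of a y g j \<mu> 0] g that
    unfolding has_real_derivative_iff_has_vector_derivative by auto
qed (use x in auto)

text \<open>
  For \<open>a = 0\<close> and \<open>y = 1\<close> the integral is the Beta function. Comparing with the substituted form for
  these end points gives the integral of \<open>abel_shift \<mu> v ^ k\<close>, and the substituted form for general end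
  points contains the same integral.
\<close>
lemma rl_kernel_shifted_power:
  assumes \<mu>: "\<mu> > 0" and y: "a < (y::real)"
  shows "((\<lambda>t. (y - t) powr (\<mu> - 1) * (t - a) ^ k) has_integral
    Gamma \<mu> * fact k * rGamma (\<mu> + real k + 1) * (y - a) powr (\<mu> + real k)) {a..y}"
proof -
  define I where "I = integral {0..1} (\<lambda>v. abel_shift \<mu> v ^ k)"
  have "((\<lambda>t. (1 - t) powr (\<mu> - 1) * t ^ k) has_integral 1 / \<mu> * I) {0..1}"
    using rl_kernel_has_integral[of \<mu> 0 1 "\<lambda>t. t ^ k"] \<mu> by (simp add: I_def continuous_intros)
  moreover have "((\<lambda>t. (1 - t) powr (\<mu> - 1) * t ^ k) has_integral Beta (real k + 1) \<mu>) {0..1}"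
    \<comment> \<open>At \<open>t = 0\<close> the integrands differ for \<open>k = 0\<close>, since \<open>0 powr 0 = 0\<close>.\<close>
    by (rule has_integral_spike_finite[OF _ _ has_integral_Beta_real[of "real k + 1" \<mu>], of "{0}"])
       (use \<mu> in \<open>auto simp: powr_realpow\<close>)
  ultimately have "1 / \<mu> * I = Beta (real k + 1) \<mu>" by (rule has_integral_unique)
  also have "\<dots> = Gamma \<mu> * fact k * rGamma (\<mu> + real k + 1)"
    by (simp add: Beta_def rGamma_inverse_Gamma field_simps Gamma_fact add_ac)
  finally have I: "1 / \<mu> * I = Gamma \<mu> * fact k * rGamma (\<mu> + real k + 1)" .
  have "((\<lambda>t. (y - t) powr (\<mu> - 1) * (t - a) ^ k) has_integral
      (y - a) powr \<mu> / \<mu> * ((y - a) ^ k * I)) {a..y}"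
    using rl_kernel_has_integral[of \<mu> a y "\<lambda>t. (t - a) ^ k"] \<mu> y
    by (simp add: I_def continuous_intros power_mult_distrib)
  also have "(y - a) powr \<mu> / \<mu> * ((y - a) ^ k * I) = (1 / \<mu> * I) * (y - a) powr (\<mu> + real k)"
    using y by (simp add: powr_add powr_realpow)
  finally show ?thesis unfolding I .
qed

text \<open>
  Binomial expansion of \<open>t ^ p = ((t - a) + a) ^ p\<close> at the base point.
\<close>
lemma rl_kernel_power:
  assumes \<mu>: "\<mu> > 0" and y: "a < (y::real)"
  shows "integral {a..y} (\<lambda>t. (y - t) powr (\<mu> - 1) * t ^ p) =
    Gamma \<mu> * (\<Sum>k=0..p. fact p / fact (p - k) * a ^ (p - k) * rGamma (\<mu> + real k + 1) * (y - a) powr (\<mu> + real k))"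
proof -
  have "((\<lambda>t. \<Sum>k=0..p. (of_nat (p choose k) * a ^ (p - k)) * ((y - t) powr (\<mu> - 1) * (t - a) ^ k)) has_integral
     (\<Sum>k=0..p. (of_nat (p choose k) * a ^ (p - k)) * (Gamma \<mu> * fact k * rGamma (\<mu> + real k + 1) * (y - a) powr (\<mu> + real k)))) {a..y}"
    by (intro has_integral_sum has_integral_mult_right rl_kernel_shifted_power \<mu> y) auto
  also have "(\<lambda>t. \<Sum>k=0..p. (of_nat (p choose k) * a ^ (p - k)) * ((y - t) powr (\<mu> - 1) * (t - a) ^ k)) =
     (\<lambda>t. (y - t) powr (\<mu> - 1) * t ^ p)"
  proof
    fix t
    have "t ^ p = ((t - a) + a) ^ p" by simp
    also have "\<dots> = (\<Sum>k=0..p. of_nat (p choose k) * (t - a) ^ k * a ^ (p - k))"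
      by (subst binomial_ring) (simp add: atMost_atLeast0)
    finally show "(\<Sum>k=0..p. (of_nat (p choose k) * a ^ (p - k)) * ((y - t) powr (\<mu> - 1) * (t - a) ^ k)) = (y - t) powr (\<mu> - 1) * t ^ p"
      by (simp add: sum_distrib_left mult_ac)
  qed
  also have "(\<Sum>k=0..p. (of_nat (p choose k) * a ^ (p - k)) * (Gamma \<mu> * fact k * rGamma (\<mu> + real k + 1) * (y - a) powr (\<mu> + real k))) =
    Gamma \<mu> * (\<Sum>k=0..p. fact p / fact (p - k) * a ^ (p - k) * rGamma (\<mu> + real k + 1) * (y - a) powr (\<mu> + real k))"
    unfolding sum_distrib_left by (intro sum.cong) (auto simp: binomial_fact field_simps)
  finally show ?thesis by (rule integral_unique)
qed

text \<open>
  The power rule lowers the Gamma argument by \<open>z * rGamma (z + 1) = rGamma z\<close>, which holds at the poles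
  of Gamma too. This is the reason for using the reciprocal Gamma function here.
\<close>
lemma iterated_deriv_rl_kernel_power:
  assumes \<mu>: "\<mu> > 0" and x: "a < (x::real)"
  shows "(deriv ^^ j) (\<lambda>y. integral {a..y} (\<lambda>t. (y - t) powr (\<mu> - 1) * t ^ p)) x =
    Gamma \<mu> * (\<Sum>k=0..p. fact p / fact (p - k) * a ^ (p - k) *
      rGamma (\<mu> + real k + 1 - real j) * (x - a) powr (\<mu> + real k - real j))"
proof (rule iterated_deriv_eqI[where S = "{a<..}" and g = "\<lambda>j y. Gamma \<mu> * (\<Sum>k=0..p. fact p / fact (p - k) * a ^ (p - k) *
      rGamma (\<mu> + real k + 1 - real j) * (y - a) powr (\<mu> + real k - real j))"])
  fix j and y :: real assume y: "y \<in> {a<..}"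
  have D: "((\<lambda>y. rGamma (\<mu> + real k + 1 - real j) * (y - a) powr (\<mu> + real k - real j)) has_field_derivative
     rGamma (\<mu> + real k + 1 - real (Suc j)) * (y - a) powr (\<mu> + real k - real (Suc j))) (at y)" for k
  proof -
    define e where "e = \<mu> + real k - real j"
    have "((\<lambda>y. (y - a) powr e) has_field_derivative e * (y - a) powr (e - 1)) (at y)"
      using y by (auto intro!: derivative_eq_intros)
    from DERIV_cmult[OF this, of "rGamma (e + 1)"]
    have "((\<lambda>y. rGamma (e + 1) * (y - a) powr e) has_field_derivative (e * rGamma (e + 1)) * (y - a) powr (e - 1)) (at y)"
      by (simp add: mult_ac)
    then show ?thesis unfolding rGamma_plus1 by (simp add: e_def algebra_simps)
  qed
  show "((\<lambda>y. Gamma \<mu> * (\<Sum>k=0..p. fact p / fact (p - k) * a ^ (p - k) *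
      rGamma (\<mu> + real k + 1 - real j) * (y - a) powr (\<mu> + real k - real j))) has_field_derivative
      Gamma \<mu> * (\<Sum>k=0..p. fact p / fact (p - k) * a ^ (p - k) *
      rGamma (\<mu> + real k + 1 - real (Suc j)) * (y - a) powr (\<mu> + real k - real (Suc j)))) (at y)"
    by (rule DERIV_cmult, rule DERIV_sum, unfold mult.assoc, rule DERIV_cmult, rule DERIV_cmult, rule D)
qed (use x rl_kernel_power[OF \<mu>] in auto)

section \<open>The operators applied to the binomial\<close>

text \<open>
  Up to a constant factor, the operator with parameters \<open>(\<mu>, j, p)\<close> applied to
  \<open>t \<mapsto> (1 + s * t\<^sup>2 / 2) powr b\<close> and to \<open>t \<mapsto> t ^ q\<close>: shifting the index of the
  sequence by \<open>p\<close> differentiates the function under the integral, and the \<open>j\<close> derivatives are taken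
  outside.
\<close>
definition rl_binom :: "real \<Rightarrow> nat \<Rightarrow> nat \<Rightarrow> real \<Rightarrow> real \<Rightarrow> complex \<Rightarrow> complex \<Rightarrow> complex" where
  "rl_binom \<mu> j p a x b s = rl_jet \<mu> a (\<lambda>k. binom_jet (k + p) b 0 0 s) j \<mu> 0 x"

definition rl_power :: "real \<Rightarrow> nat \<Rightarrow> nat \<Rightarrow> real \<Rightarrow> real \<Rightarrow> nat \<Rightarrow> real" where
  "rl_power \<mu> j p a x q = rl_jet \<mu> a (\<lambda>k. power_jet (k + p) q) j \<mu> 0 x"

lemma abs_le_max_ends: "t \<in> {a..x} \<Longrightarrow> \<bar>t\<bar> \<le> max \<bar>a\<bar> \<bar>x\<bar>" for t a x :: real
  by auto

lemma rl_binom_sums: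
  assumes \<mu>: "\<mu> > 0" and x: "a < x" and s: "norm s < 2 / (max \<bar>a\<bar> \<bar>x\<bar>)\<^sup>2"
  shows "(\<lambda>n. (b gchoose n) / 2 ^ n * of_real (rl_power \<mu> j p a x (2 * n)) * s ^ n) sums rl_binom \<mu> j p a x b s"
proof -
  define M where "M = max \<bar>a\<bar> \<bar>x\<bar>"
  have M: "M > 0" using x by (auto simp: M_def)
  define c where "c n = (b gchoose n) / 2 ^ n * s ^ n" for n
  have "(\<lambda>n. rl_jet \<mu> a (\<lambda>k t. c n * of_real (power_jet (k + p) (2 * n) t)) j \<mu> 0 x) sums
      rl_jet \<mu> a (\<lambda>k. binom_jet (k + p) b 0 0 s) j \<mu> 0 x"
  proof (rule rl_jet_sums[OF \<mu> less_imp_le[OF x]])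
    show "continuous_on {a..x} (\<lambda>t. c n * of_real (power_jet (k + p) (2 * n) t))" for n k
      by (intro continuous_intros)
    show "(\<lambda>n. c n * of_real (power_jet (k + p) (2 * n) t)) sums binom_jet (k + p) b 0 0 s t"
      if "t \<in> {a..x}" for k t
      using binom_jet_sums[OF s abs_le_max_ends[OF that], of b 0 "k + p" 0] by (simp add: c_def)
    show "norm (c n * of_real (power_jet (k + p) (2 * n) t)) \<le> norm (c n) * power_jet (k + p) (2 * n) M"
      if "t \<in> {a..x}" for n k t
      using power_jet_abs_le[OF abs_le_max_ends[OF that], of "k + p" "2 * n"]
      by (simp add: norm_mult M_def mult_left_mono)
    show "summable (\<lambda>n. norm (c n) * power_jet (k + p) (2 * n) M)" for k
      unfolding c_def by (rule binom_jet_majorant_summable) (use s M in \<open>auto simp: M_def\<close>)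
  qed
  also have "(\<lambda>n. rl_jet \<mu> a (\<lambda>k t. c n * of_real (power_jet (k + p) (2 * n) t)) j \<mu> 0 x) =
      (\<lambda>n. c n * of_real (rl_power \<mu> j p a x (2 * n)))"
    unfolding rl_power_def
    by (intro ext rl_jet_linear \<mu> less_imp_le[OF x] continuous_intros)
       (auto intro: bounded_linear_compose[OF bounded_linear_mult_right bounded_linear_of_real])
  finally show ?thesis by (simp add: rl_binom_def c_def mult_ac)
qed

lemma rl_binom_holomorphic:
  assumes \<mu>: "\<mu> > 0" and x: "a < x"
  shows "rl_binom \<mu> j p a x b holomorphic_on {s. Re s > - (2 / (max \<bar>a\<bar> \<bar>x\<bar>)\<^sup>2)}"
proof -
  define U where "U = {s. Re s > - (2 / (max \<bar>a\<bar> \<bar>x\<bar>)\<^sup>2)}"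
  have pos: "Re (1 + s * of_real (t\<^sup>2 / 2)) > 0" if "s \<in> U" "t \<in> {a..x}" for s t
    using halfplane_binomial_base[OF _ abs_le_max_ends[OF that(2)]] that(1) by (simp add: U_def)
  show ?thesis unfolding rl_binom_def U_def[symmetric]
  proof (rule rl_jet_holomorphic_param[OF \<mu> less_imp_le[OF x]])
    show "convex U" unfolding U_def by (rule convex_halfspace_Re_gt)
    show "((\<lambda>s. binom_jet (k + p) b 0 0 s t) has_field_derivative
       b / 2 * binom_jet (k + p) (b - 1) 2 0 s t) (at s)" if "s \<in> U" "t \<in> {a..x}" for k s t
      using binom_jet_has_field_derivative_param[OF pos[OF that], of "k + p" b 0 0] by (simp add: numeral_2_eq_2)
    show "continuous_on (U \<times> {a..x}) (\<lambda>(s, t). binom_jet (k + p) b 0 0 s t)"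
      "continuous_on (U \<times> {a..x}) (\<lambda>(s, t). b / 2 * binom_jet (k + p) (b - 1) 2 0 s t)" for k
      unfolding case_prod_beta using pos
      by (intro continuous_intros binom_jet_continuous; force)+
  qed
qed

text \<open>
  The base \<open>1 + t\<^sup>2 / 2\<close> is positive for all real \<open>t\<close>, so its powers are jointly continuous in the
  exponent and in \<open>t\<close>. The limit statements at the poles of the prefactor rest on this.
\<close>
lemma rl_binom_continuous_exponent:
  assumes \<mu>: "\<mu> > 0" and x: "a < x"
  shows "continuous_on UNIV (\<lambda>b. rl_binom \<mu> j p a x b 1)"
  unfolding rl_binom_def
proof (rule rl_jet_continuous_param[OF \<mu> less_imp_le[OF x]])
  have "Re (1 + 1 * of_real (t\<^sup>2 / 2)) > 0" for t :: real
    by (simp add: add_pos_nonneg)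
  then show "continuous_on (UNIV \<times> {a..x}) (\<lambda>(b, t). binom_jet (k + p) b 0 0 1 t)" for k
    unfolding case_prod_beta
    by (intro binom_jet_continuous continuous_intros) auto
qed

lemma of_real_gbinomial: "(of_real b gchoose n) = (of_real (b gchoose n) :: complex)"
  by (simp add: gbinomial_prod_rev)

text \<open>
  For \<open>M < sqrt 2\<close> the point \<open>s = 1\<close> is in the disc of convergence; otherwise convergence at \<open>1\<close> is a
  hypothesis and the value of the sum comes from analytic continuation.
\<close>
lemma rl_binom_series_at_1:
  fixes b \<mu> a x :: real and j p :: nat
  assumes \<mu>: "\<mu> > 0" and x: "a < x"
  defines "d \<equiv> \<lambda>n. (b gchoose n) / 2 ^ n * rl_power \<mu> j p a x (2 * n)"
  shows "summable d \<Longrightarrow> suminf d = Re (rl_binom \<mu> j p a x (of_real b) 1)"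
    and "\<bar>a\<bar> < sqrt 2 \<Longrightarrow> \<bar>x\<bar> < sqrt 2 \<Longrightarrow> summable d"
proof -
  define M where "M = max \<bar>a\<bar> \<bar>x\<bar>"
  have M: "M > 0" using x by (auto simp: M_def)
  have near: "(\<lambda>n. of_real (d n) * s ^ n) sums rl_binom \<mu> j p a x (of_real b) s" if "norm s < 2 / M\<^sup>2" for s
    using rl_binom_sums[OF \<mu> x that[unfolded M_def], of "of_real b" j p]
    by (simp add: d_def of_real_gbinomial)
  show "suminf d = Re (rl_binom \<mu> j p a x (of_real b) 1)" if d: "summable d"
  proof -
    have "suminf (\<lambda>n. of_real (d n)) = rl_binom \<mu> j p a x (of_real b) 1"
    proof (rule convergent_series_eq_continuation)
      show "rl_binom \<mu> j p a x (of_real b) holomorphic_on {s. Re s > - (2 / M\<^sup>2)}"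
        unfolding M_def by (rule rl_binom_holomorphic[OF \<mu> x])
      show "2 / M\<^sup>2 > 0" using M by simp
      show "summable (\<lambda>n. complex_of_real (d n))" using d by (rule summable_of_real)
    qed (rule near)
    then have "Re (rl_binom \<mu> j p a x (of_real b) 1) = Re (complex_of_real (suminf d))"
      by (simp add: suminf_of_real[OF d])
    then show ?thesis by simp
  qed
  show "summable d" if "\<bar>a\<bar> < sqrt 2" "\<bar>x\<bar> < sqrt 2"
  proof -
    have "M < sqrt 2" using that by (simp add: M_def)
    then have "M\<^sup>2 < 2" using power_strict_mono[of M "sqrt 2" 2] M by simp
    then have "norm (1::complex) < 2 / M\<^sup>2" using M by (simp add: field_simps)
    from sums_Re[OF near[OF this]] show ?thesis by (simp add: sums_iff)
  qed
qed

text \<open>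
  The complex derivatives at \<open>s = 1\<close> are turned into iterated real derivatives by taking real parts.
\<close>
lemma iterated_deriv_binom:
  fixes \<gamma> :: real
  defines "g \<equiv> \<lambda>k t. Re (binom_jet k (of_real \<gamma>) 0 0 1 t)"
  shows "(g k has_field_derivative g (Suc k) t) (at t)"
    and "(deriv ^^ p) (\<lambda>t. (1 + t\<^sup>2 / 2) powr \<gamma>) t = g p t"
proof -
  show der: "(g k has_field_derivative g (Suc k) t) (at t)" for k t
  proof -
    have "Re (1 + 1 * of_real (t\<^sup>2 / 2)) > 0" by (simp add: add_pos_nonneg)
    from bounded_linear.has_vector_derivative[OF bounded_linear_Re binom_jet_has_vector_derivative[OF this]]
    show ?thesis unfolding g_def has_real_derivative_iff_has_vector_derivative .
  qed
  show "(deriv ^^ p) (\<lambda>t. (1 + t\<^sup>2 / 2) powr \<gamma>) t = g p t"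
    by (rule iterated_deriv_eqI[where S = UNIV])
       (use der binom_jet_at_1[of \<gamma>] in \<open>auto simp: g_def simp del: binom_jet.simps\<close>)
qed

lemma iterated_deriv_rl_kernel_binom:
  assumes \<mu>: "\<mu> > 0" and x: "a < x"
  shows "(deriv ^^ j) (\<lambda>y. integral {a..y} (\<lambda>t. (y - t) powr (\<mu> - 1) * (deriv ^^ p) (\<lambda>t. (1 + t\<^sup>2 / 2) powr \<gamma>) t)) x
     = Re (rl_binom \<mu> j p a x (of_real \<gamma>) 1)"
proof -
  define B where "B k = binom_jet (k + p) (of_real \<gamma>) 0 0 1" for k
  have "(deriv ^^ j) (\<lambda>y. integral {a..y} (\<lambda>t. (y - t) powr (\<mu> - 1) * Re (B 0 t))) x
      = rl_jet \<mu> a (\<lambda>k t. Re (B k t)) j \<mu> 0 x"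
    by (rule iterated_deriv_rl_kernel[OF \<mu> x])
       (use iterated_deriv_binom(1)[of "_ + p" \<gamma>] in \<open>simp add: B_def del: binom_jet.simps\<close>)
  also have "\<dots> = Re (rl_jet \<mu> a B j \<mu> 0 x)"
  proof (rule rl_jet_linear[OF \<mu> less_imp_le[OF x] _ bounded_linear_Re])
    show "continuous_on {a..x} (B k)" for k
      unfolding B_def by (intro binom_jet_continuous continuous_intros) (simp add: add_pos_nonneg)
  qed
  finally show ?thesis by (simp add: iterated_deriv_binom(2) B_def[abs_def] rl_binom_def)
qed

lemma rl_power_iterated_deriv:
  assumes \<mu>: "\<mu> > 0" and x: "a < x"
  shows "rl_power \<mu> j p a x q =
    (deriv ^^ j) (\<lambda>y. integral {a..y} (\<lambda>t. (y - t) powr (\<mu> - 1) * power_jet p q t)) x"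
proof -
  have "(power_jet (k + p) q has_field_derivative power_jet (Suc k + p) q t) (at t)" for k and t :: real
    using power_jet_has_derivative[of "k + p" q t] by simp
  from iterated_deriv_rl_kernel[of \<mu> a x "\<lambda>k. power_jet (k + p) q", OF \<mu> x this]
  show ?thesis by (simp add: rl_power_def)
qed

lemma rl_power_deriv_of_integral:
  assumes \<mu>: "\<mu> > 0" and x: "a < x"
  shows "rl_power \<mu> j 0 a x q = Gamma \<mu> * (\<Sum>k=0..q. fact q / fact (q - k) * a ^ (q - k) *
      rGamma (\<mu> + real k + 1 - real j) * (x - a) powr (\<mu> + real k - real j))"
  using iterated_deriv_rl_kernel_power[OF \<mu> x] by (simp add: rl_power_iterated_deriv[OF \<mu> x])

lemma rl_power_integral_of_deriv:
  assumes \<mu>: "\<mu> > 0" and x: "a < x"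
  shows "rl_power \<mu> 0 p a x q = Gamma \<mu> * (\<Sum>k | k + p \<le> q. fact q / fact (q - p - k) * a ^ (q - p - k) *
      rGamma (\<mu> + real k + 1) * (x - a) powr (\<mu> + real k))"
proof (cases "p \<le> q")
  case True
  define c :: real where "c = fact q / fact (q - p)"
  have "rl_power \<mu> 0 p a x q = integral {a..x} (\<lambda>t. c * ((x - t) powr (\<mu> - 1) * t ^ (q - p)))"
    using True by (simp add: rl_power_iterated_deriv[OF \<mu> x] power_jet_closed_form c_def mult_ac)
  also have "\<dots> = c * integral {a..x} (\<lambda>t. (x - t) powr (\<mu> - 1) * t ^ (q - p))"
    by simp
  also have "\<dots> = Gamma \<mu> * (\<Sum>k=0..q-p. fact q / fact (q - p - k) * a ^ (q - p - k) *
      rGamma (\<mu> + real k + 1) * (x - a) powr (\<mu> + real k))"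
    unfolding rl_kernel_power[OF \<mu> x] sum_distrib_left by (intro sum.cong) (auto simp: c_def)
  also have "{0..q-p} = {k. k + p \<le> q}" using True by auto
  finally show ?thesis .
next
  case False
  then have "{k. k + p \<le> q} = {}" by auto
  then show ?thesis using False by (simp add: rl_power_iterated_deriv[OF \<mu> x] power_jet_closed_form)
qed

section \<open>The series expansions\<close>

text \<open>
  The common form of the three expansions: \<open>c\<close> is the power of \<open>x - a\<close> (and of \<open>a\<close>) in front of the
  series, \<open>S n\<close> is the inner sum, and \<open>\<kappa>\<close> is the normalising factor of the operator. Away from the
  poles, the terms are the Taylor coefficients in \<open>s\<close> up to a factor independent of \<open>n\<close>, because
  \<open>(b/2 gchoose n) = Gamma (1 + b/2) / (n! * Gamma (b/2 - n + 1))\<close>. If \<open>1 + b/2\<close> is a pole, so is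
  \<open>b/2 - n + 1\<close> and all terms vanish; if \<open>b = 2 l\<close>, the terms with \<open>n > l\<close> vanish.
\<close>
lemma fractional_binom_series:
  fixes T :: "real \<Rightarrow> nat \<Rightarrow> real" and Op :: "real \<Rightarrow> real" and S :: "nat \<Rightarrow> real"
  assumes \<mu>: "\<mu> > 0" and x: "a < x" and c: "c \<noteq> 0"
    and T: "\<And>b n. T b n = fact (2 * n) / (2 ^ n * fact n * Gamma (b / 2 - real n + 1)) * S n"
    and S: "\<And>n. \<kappa> * rl_power \<mu> j p a x (2 * n) = c * (fact (2 * n) * S n)"
    and Op: "\<And>b. Op b = \<kappa> * Re (rl_binom \<mu> j p a x (of_real (b / 2)) 1)"
  shows "1 + b / 2 \<notin> \<int>\<^sub>\<le>\<^sub>0 \<Longrightarrow> summable (T b) \<Longrightarrow> Op b = Gamma (1 + b / 2) * c * suminf (T b)"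
    and "(\<bar>a\<bar> < sqrt 2 \<and> \<bar>x\<bar> < sqrt 2) \<or> (\<exists>l::nat. b = 2 * real l) \<Longrightarrow> summable (T b)"
    and "1 + b / 2 \<in> \<int>\<^sub>\<le>\<^sub>0 \<Longrightarrow> \<bar>a\<bar> < sqrt 2 \<Longrightarrow> \<bar>x\<bar> < sqrt 2 \<Longrightarrow>
      ((\<lambda>b. Gamma (1 + b / 2) * c * suminf (T b)) \<longlongrightarrow> Op b) (at b)"
proof -
  define d where "d b n = (b / 2 gchoose n) / 2 ^ n * rl_power \<mu> j p a x (2 * n)" for b n
  have T_d: "T b n = \<kappa> / (Gamma (1 + b / 2) * c) * d b n" if b: "1 + b / 2 \<notin> \<int>\<^sub>\<le>\<^sub>0" for b n
  proof -
    have G: "Gamma (1 + b / 2) \<noteq> 0" using b by (simp add: Gamma_eq_zero_iff)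
    have "\<kappa> / (Gamma (1 + b / 2) * c) * d b n =
        (b / 2 gchoose n) / 2 ^ n * (\<kappa> * rl_power \<mu> j p a x (2 * n)) / (Gamma (1 + b / 2) * c)"
      by (simp add: d_def mult_ac)
    also have "\<dots> = (b / 2 gchoose n) / 2 ^ n * (fact (2 * n) * S n) / Gamma (1 + b / 2)"
      unfolding S using c by simp
    also have "(b / 2 gchoose n) = Gamma (1 + b / 2) / (fact n * Gamma (b / 2 - real n + 1))"
      using gbinomial_Gamma[of "b / 2" n] b by (simp add: add.commute)
    also have "\<dots> / 2 ^ n * (fact (2 * n) * S n) / Gamma (1 + b / 2) = T b n"
      using G by (simp add: T)
    finally show ?thesis ..
  qed
  have Op_eq: "Op b = Gamma (1 + b / 2) * c * suminf (T b)" if b: "1 + b / 2 \<notin> \<int>\<^sub>\<le>\<^sub>0" and sT: "summable (T b)" for b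
  proof (cases "\<kappa> = 0")
    case True
    then have "T b = (\<lambda>_. 0)" using T_d[OF b] by (simp add: fun_eq_iff)
    then show ?thesis using True by (simp add: Op)
  next
    case False
    define e where "e = \<kappa> / (Gamma (1 + b / 2) * c)"
    have G: "Gamma (1 + b / 2) \<noteq> 0" using b by (simp add: Gamma_eq_zero_iff)
    have e: "e \<noteq> 0" using False G c by (simp add: e_def)
    have T_e: "T b = (\<lambda>n. e * d b n)" using T_d[OF b] by (auto simp: e_def)
    then have sd: "summable (d b)" using sT e by (simp add: summable_cmult_iff)
    have "Op b = \<kappa> * suminf (d b)"
      unfolding Op using rl_binom_series_at_1(1)[OF \<mu> x, of "b / 2" j p] sd by (simp add: d_def[abs_def])
    also have "\<kappa> = Gamma (1 + b / 2) * c * e" using G c by (simp add: e_def)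
    finally show ?thesis using sd by (simp add: T_e suminf_mult mult.assoc)
  qed
  then show "1 + b / 2 \<notin> \<int>\<^sub>\<le>\<^sub>0 \<Longrightarrow> summable (T b) \<Longrightarrow> Op b = Gamma (1 + b / 2) * c * suminf (T b)" .
  have sT: "summable (T b)" if "\<bar>a\<bar> < sqrt 2" "\<bar>x\<bar> < sqrt 2" for b
  proof (cases "1 + b / 2 \<in> \<int>\<^sub>\<le>\<^sub>0")
    case True
    have "Gamma (b / 2 - real n + 1) = 0" for n
    proof -
      from True obtain i where i: "1 + b / 2 = of_int i" "i \<le> 0" by (auto elim: nonpos_Ints_cases)
      then have "b / 2 - real n + 1 = of_int (i - int n)" "i - int n \<le> 0" by auto
      then show ?thesis by (metis Gamma_eq_zero_iff nonpos_Ints_of_int)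
    qed
    then show ?thesis by (simp add: T[abs_def])
  next
    case False
    have "summable (d b)" unfolding d_def by (rule rl_binom_series_at_1(2)[OF \<mu> x that])
    moreover have "T b = (\<lambda>n. \<kappa> / (Gamma (1 + b / 2) * c) * d b n)" by (rule ext) (rule T_d[OF False])
    ultimately show ?thesis by (simp only: summable_mult)
  qed
  show "summable (T b)" if "(\<bar>a\<bar> < sqrt 2 \<and> \<bar>x\<bar> < sqrt 2) \<or> (\<exists>l::nat. b = 2 * real l)"
    using that
  proof
    assume "\<exists>l::nat. b = 2 * real l"
    then obtain l where l: "b = 2 * real l" by blast
    show ?thesis
    proof (rule summable_finite[of "{..l}"])
      fix n assume "n \<notin> {..l}"
      then have "b / 2 - real n + 1 = - of_nat (n - l - 1)" by (simp add: l of_nat_diff)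
      then have "Gamma (b / 2 - real n + 1) = 0" by (metis Gamma_eq_zero_iff minus_of_nat_in_nonpos_Ints)
      then show "T b n = 0" by (simp add: T)
    qed simp
  qed (use sT in auto)
  show "((\<lambda>b. Gamma (1 + b / 2) * c * suminf (T b)) \<longlongrightarrow> Op b) (at b)"
    if b: "1 + b / 2 \<in> \<int>\<^sub>\<le>\<^sub>0" and ax: "\<bar>a\<bar> < sqrt 2" "\<bar>x\<bar> < sqrt 2"
  proof (rule Lim_transform_eventually)
    have "continuous_on UNIV Op"
      unfolding Op[abs_def]
      by (intro continuous_intros continuous_on_compose2[OF rl_binom_continuous_exponent[OF \<mu> x]]) auto
    then show "(Op \<longlongrightarrow> Op b) (at b)" by (simp add: continuous_on_eq_continuous_at isCont_def)
    \<comment> \<open>Consecutive values of \<open>b\<close> at which \<open>1 + b / 2\<close> is an integer have distance \<open>2\<close>.\<close>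
    have "\<forall>\<^sub>F b' in at b. b' \<noteq> b \<and> dist b' b < 2"
      by (intro eventually_conj eventually_neq_at_within) (auto simp: eventually_at intro: exI[of _ 2])
    then show "\<forall>\<^sub>F b' in at b. Op b' = Gamma (1 + b' / 2) * c * suminf (T b')"
    proof eventually_elim
      case (elim b')
      have "1 + b' / 2 \<notin> \<int>\<^sub>\<le>\<^sub>0"
      proof
        assume "1 + b' / 2 \<in> \<int>\<^sub>\<le>\<^sub>0"
        with b obtain i i' where i: "1 + b / 2 = of_int i" "1 + b' / 2 = of_int i'"
          by (auto elim!: nonpos_Ints_cases)
        then have "\<bar>real_of_int (i - i')\<bar> < 1" using elim by (simp add: dist_real_def) linarith
        then have "\<bar>i - i'\<bar> < 1" by (simp only: of_int_less_1_iff flip: of_int_abs)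
        then have "i = i'" by simp
        then show False using i elim by simp
      qed
      then show ?case by (rule Op_eq[OF _ sT[OF ax]])
    qed
  qed
qed

theorem theorem13:
  fixes \<alpha> \<beta> a x :: real and m :: nat and f :: "real \<Rightarrow> real"
  assumes "\<alpha> > 0" and "\<alpha> \<notin> \<int>" and "m = nat \<lceil>\<alpha>\<rceil>"
    and "a \<noteq> 0" and "x > a"
    and "f = (\<lambda>t. (1 + t ^ 2 / 2) powr (\<beta> / 2))"
  shows
    "(1 + \<beta> / 2 \<notin> \<int>\<^sub>\<le>\<^sub>0 \<longrightarrow>
        (summable (RL_integral_term a \<alpha> x \<beta>) \<longrightarrow>
           RL_integral a \<alpha> f x =
             Gamma (1 + \<beta> / 2) * (x - a) powr \<alpha> * (\<Sum>n. RL_integral_term a \<alpha> x \<beta> n)) \<and>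
        (summable (RL_deriv_term a \<alpha> x \<beta>) \<longrightarrow>
           RL_deriv a \<alpha> f x =
             Gamma (1 + \<beta> / 2) * (x - a) powr (- \<alpha>) * (\<Sum>n. RL_deriv_term a \<alpha> x \<beta> n)) \<and>
        (summable (Caputo_deriv_term a \<alpha> x \<beta>) \<longrightarrow>
           Caputo_deriv a \<alpha> f x =
             Gamma (1 + \<beta> / 2) * a powi (- int m) * (x - a) powr (real m - \<alpha>) *
               (\<Sum>n. Caputo_deriv_term a \<alpha> x \<beta> n))) \<and>
     ((\<bar>a\<bar> < sqrt 2 \<and> \<bar>x\<bar> < sqrt 2) \<or> (\<exists>j::nat. \<beta> = 2 * real j) \<longrightarrow>
        summable (RL_integral_term a \<alpha> x \<beta>) \<and>
        summable (RL_deriv_term a \<alpha> x \<beta>) \<and>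
        summable (Caputo_deriv_term a \<alpha> x \<beta>)) \<and>
     (1 + \<beta> / 2 \<in> \<int>\<^sub>\<le>\<^sub>0 \<and> \<bar>a\<bar> < sqrt 2 \<and> \<bar>x\<bar> < sqrt 2 \<longrightarrow>
        ((\<lambda>b. Gamma (1 + b / 2) * (x - a) powr \<alpha> * (\<Sum>n. RL_integral_term a \<alpha> x b n))
           \<longlongrightarrow> RL_integral a \<alpha> f x) (at \<beta>) \<and>
        ((\<lambda>b. Gamma (1 + b / 2) * (x - a) powr (- \<alpha>) * (\<Sum>n. RL_deriv_term a \<alpha> x b n))
           \<longlongrightarrow> RL_deriv a \<alpha> f x) (at \<beta>) \<and>
        ((\<lambda>b. Gamma (1 + b / 2) * a powi (- int m) * (x - a) powr (real m - \<alpha>) *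
               (\<Sum>n. Caputo_deriv_term a \<alpha> x b n))
           \<longlongrightarrow> Caputo_deriv a \<alpha> f x) (at \<beta>))"
proof -
  define F where "F b = (\<lambda>t::real. (1 + t\<^sup>2 / 2) powr (b / 2))" for b :: real
  have f: "f = F \<beta>" using assms(6) by (simp add: F_def)
  define \<mu> where "\<mu> = real m - \<alpha>"
  have "\<alpha> \<noteq> of_int \<lceil>\<alpha>\<rceil>" using assms(2) by (metis Ints_of_int)
  moreover have "real m = of_int \<lceil>\<alpha>\<rceil>" using assms(1,3) by simp
  ultimately have \<mu>: "\<mu> > 0" using le_of_int_ceiling[of \<alpha>] unfolding \<mu>_def by linarith
  have x: "a < x" using assms(5) .
  have G: "Gamma \<alpha> > 0" "Gamma \<mu> > 0" using assms(1) \<mu> by (simp_all add: Gamma_real_pos)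
  have pw: "(x - a) powr (\<nu> + real k) = (x - a) powr \<nu> * (x - a) ^ k" for \<nu> k
    using x by (simp add: powr_add powr_realpow)

  have A_S: "1 / Gamma \<alpha> * rl_power \<alpha> 0 0 a x (2 * n) = (x - a) powr \<alpha> * (fact (2 * n) *
      (\<Sum>k = 0..2 * n. a ^ (2 * n - k) * (x - a) ^ k / (fact (2 * n - k) * Gamma (\<alpha> + real k + 1))))" for n
    unfolding rl_power_deriv_of_integral[OF assms(1) x] sum_distrib_left
    using G by (intro sum.cong) (auto simp: pw rGamma_inverse_Gamma divide_inverse)
  have A_Op: "RL_integral a \<alpha> (F b) x = 1 / Gamma \<alpha> * Re (rl_binom \<alpha> 0 0 a x (of_real (b / 2)) 1)" for b
    using iterated_deriv_rl_kernel_binom[OF assms(1) x, of 0 0 "b / 2"] by (simp add: RL_integral_def F_def)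
  note A = fractional_binom_series[where T = "RL_integral_term a \<alpha> x" and Op = "\<lambda>b. RL_integral a \<alpha> (F b) x",
      OF assms(1) x _ RL_integral_term_def A_S A_Op, of \<beta>]

  have D_exp: "\<mu> + real k - real m = - \<alpha> + real k" for k by (simp add: \<mu>_def)
  have D_arg: "\<mu> + real k + 1 - real m = real k - \<alpha> + 1" for k by (simp add: \<mu>_def)
  have D_S: "1 / Gamma \<mu> * rl_power \<mu> m 0 a x (2 * n) = (x - a) powr (- \<alpha>) * (fact (2 * n) *
      (\<Sum>k = 0..2 * n. a ^ (2 * n - k) * (x - a) ^ k / (fact (2 * n - k) * Gamma (real k - \<alpha> + 1))))" for n
    unfolding rl_power_deriv_of_integral[OF \<mu> x] sum_distrib_left D_exp D_arg pw
    using G by (intro sum.cong) (auto simp: rGamma_inverse_Gamma divide_inverse)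
  have D_Op: "RL_deriv a \<alpha> (F b) x = 1 / Gamma \<mu> * Re (rl_binom \<mu> m 0 a x (of_real (b / 2)) 1)" for b
    using iterated_deriv_rl_kernel_binom[OF \<mu> x, of m 0 "b / 2"]
    by (simp add: RL_deriv_def F_def Let_def \<mu>_def flip: assms(3))
  note D = fractional_binom_series[where T = "RL_deriv_term a \<alpha> x" and Op = "\<lambda>b. RL_deriv a \<alpha> (F b) x",
      OF \<mu> x _ RL_deriv_term_def D_S D_Op, of \<beta>]

  have C_T: "Caputo_deriv_term a \<alpha> x b n =
      fact (2 * n) / (2 ^ n * fact n * Gamma (b / 2 - real n + 1)) *
        (\<Sum>k | k + m \<le> 2 * n. a ^ (2 * n - k) * (x - a) ^ k /
          (fact (2 * n - m - k) * Gamma (real m - \<alpha> + real k + 1)))" for b n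
    by (simp add: Caputo_deriv_term_def Let_def flip: assms(3))
  have C_S: "1 / Gamma \<mu> * rl_power \<mu> 0 m a x (2 * n) = (a powi (- int m) * (x - a) powr (real m - \<alpha>)) * (fact (2 * n) *
      (\<Sum>k | k + m \<le> 2 * n. a ^ (2 * n - k) * (x - a) ^ k /
          (fact (2 * n - m - k) * Gamma (real m - \<alpha> + real k + 1))))" for n
    unfolding rl_power_integral_of_deriv[OF \<mu> x] sum_distrib_left \<mu>_def[symmetric]
  proof (intro sum.cong refl)
    fix k assume "k \<in> {k. k + m \<le> 2 * n}"
    then have "2 * n - k = m + (2 * n - m - k)" by auto
    then have "a ^ (2 * n - k) = a ^ m * a ^ (2 * n - m - k)" by (metis power_add)
    then have "a powi (- int m) * a ^ (2 * n - k) = a ^ (2 * n - m - k)"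
      using assms(4) by (simp add: power_int_minus)
    then show "1 / Gamma \<mu> * (Gamma \<mu> * (fact (2 * n) / fact (2 * n - m - k) * a ^ (2 * n - m - k) *
          rGamma (\<mu> + real k + 1) * (x - a) powr (\<mu> + real k))) =
        a powi (- int m) * (x - a) powr \<mu> * (fact (2 * n) * (a ^ (2 * n - k) * (x - a) ^ k /
          (fact (2 * n - m - k) * Gamma (\<mu> + real k + 1))))"
      using G by (simp add: pw rGamma_inverse_Gamma divide_inverse flip: \<open>_ = a ^ (2 * n - m - k)\<close>)
  qed
  have C_Op: "Caputo_deriv a \<alpha> (F b) x = 1 / Gamma \<mu> * Re (rl_binom \<mu> 0 m a x (of_real (b / 2)) 1)" for b
    using iterated_deriv_rl_kernel_binom[OF \<mu> x, of 0 m "b / 2"]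
    by (simp add: Caputo_deriv_def F_def Let_def \<mu>_def flip: assms(3))
  note C = fractional_binom_series[where T = "Caputo_deriv_term a \<alpha> x" and Op = "\<lambda>b. Caputo_deriv a \<alpha> (F b) x",
      OF \<mu> x _ C_T C_S C_Op, of \<beta>]

  have nz: "(x - a) powr \<alpha> \<noteq> 0" "(x - a) powr (- \<alpha>) \<noteq> 0" "a powi (- int m) * (x - a) powr (real m - \<alpha>) \<noteq> 0"
    using x assms(4) by auto
  show ?thesis
    unfolding f using A[OF nz(1)] D[OF nz(2)] C[OF nz(3)] by (simp add: mult.assoc)
qed

end
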